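(* Let $C\subseteq\{N,H,D,R,L,Fa,Fu\}$. Then for all sequents $\{\Gamma_i\Rightarrow\Delta_i\}_{i\in I}$ and $\Gamma\Rightarrow\Delta$: $\{\Gamma_i\Rightarrow\Delta_i\}_{i\in I}\vdash_{\mathbf{STL}(C)}\Gamma\Rightarrow\Delta$ iff $\{\Gamma_i\Rightarrow\Delta_i\}_{i\in I}\vDash_{\mathcal{V}(C)}\Gamma\Rightarrow\Delta$.
   Context: \textbf{Calculus.} Language $\mathcal{L}=\{\wedge,\vee,\to,\top,\bot,\nabla\}$. When $H\in C$ the language is $\mathcal{L}\cup\{\supset\}$. A sequent is $\Gamma\Rightarrow\Delta$ with $\Gamma,\Delta$ finite multisets, $|\Delta|\le1$; $\nabla\Gamma=\{\nabla\gamma\mid\gamma\in\Gamma\}$. $\mathbf{STL}$ rules (premises / conclusion): - Axioms: $A\Rightarrow A$; $\bot\Rightarrow$; $\Rightarrow\top$. - Weakening: $\Gamma\Rightarrow\Delta$ / $\Gamma,A\Rightarrow\Delta$; $\Gamma\Rightarrow$ / $\Gamma\Rightarrow A$. - Contraction: $\Gamma,A,A\Rightarrow\Delta$ / $\Gamma,A\Rightarrow\Delta$. - Cut: $\Gamma\Rightarrow A$, $\Pi,A\Rightarrow\Delta$ / $\Pi,\Gamma\Rightarrow\Delta$. - Conjunction: $\Gamma,A\Rightarrow\Delta$ / $\Gamma,A\wedge B\Rightarrow\Delta$; $\Gamma,B\Rightarrow\Delta$ / $\Gamma,A\wedge B\Rightarrow\Delta$; $\Gamma\Rightarrow A$, $\Gamma\Rightarrow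 B$ / $\Gamma\Rightarrow A\wedge B$. - Disjunction: $A\Rightarrow\Delta$, $B\Rightarrow\Delta$ / $A\vee B\Rightarrow\Delta$; $\Gamma\Rightarrow A$ / $\Gamma\Rightarrow A\vee B$; $\Gamma\Rightarrow B$ / $\Gamma\Rightarrow A\vee B$. - Modality: $A\Rightarrow B$ / $\nabla A\Rightarrow\nabla B$. - Left implication: $\Gamma\Rightarrow A$, $\Gamma,B\Rightarrow\Delta$ / $\Gamma,\nabla(A\to B)\Rightarrow\Delta$. - Right implication: $\nabla\Gamma,A\Rightarrow B$ / $\Gamma\Rightarrow A\to B$. Additional rules: - (R): $\Gamma\Rightarrow A$ / $\Gamma\Rightarrow\nabla A$. - (L): $\Gamma,A\Rightarrow\Delta$ / $\Gamma,\nabla A\Rightarrow\Delta$. - (D): $\Gamma,A\Rightarrow\Delta$, $\Gamma,B\Rightarrow\Delta$ / $\Gamma,A\vee B\Rightarrow\Delta$. - (N): $\Gamma\Rightarrow\Delta$ / $\nabla\Gamma\Rightarrow\nabla\Delta$. - (Fa): $\Gamma,A\Rightarrow B$ / $\Gamma\Rightarrow\nabla(A\to B)$. - (Fu): $\nabla\Gamma\Rightarrow A$, $\nabla\Gamma,B\Rightarrow\nabla\Delta$ / $\Gamma,A\to B\Rightarrow\Delta$. - (H): adds the intuitionistic implication rules $\Gamma\Rightarrow A$, $\Gamma,B\Rightarrow\Delta$ / $\Gamma,A\supset B\Rightarrow\Delta$ and $\Gamma,A\Rightarrow B$ / $\Gamma\Rightarrow A\supset B$. $\mathbf{STL}(C)$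 is $\mathbf{STL}$ plus the rules in $C$. $\mathcal{S}\vdash_G S$ means $S$ is derivable from premises $\mathcal{S}$ by finitely many rule applications of $G$. \textbf{Algebras.} A $\nabla$-algebra is $(\mathsf{A},\nabla,\to)$ with $\mathsf{A}$ a bounded lattice and $\nabla c\wedge a\le b$ iff $c\le a\to b$. Properties: - N: $\nabla1=1$, $\nabla(a\wedge b)=\nabla a\wedge\nabla b$. - H: $\mathsf{A}$ a Heyting algebra. - D: distributive. - R: $a\le\nabla a$. - L: $\nabla a\le a$. - Fa: $\nabla$ surjective. - Fu: $a\mapsto1\to a$ surjective. $\mathcal{V}(C)$ is the class of $\nabla$-algebras with the properties in $C$. \textbf{Semantics.} An algebraic model is a $\nabla$-algebra with a valuation $V$ from formulas to $A$ commuting with all connectives: $\top,\bot$ go to $1,0$; $\nabla$ goes to $\nabla$; $\wedge,\vee,\to$ go to the corresponding operations; $\supset$ goes to the Heyting implication when present. $(\mathcal{A},V)\vDash\Gamma\Rightarrow\Delta$ if $\bigwedge V[\Gamma]\le\bigvee V[\Delta]$. $\mathcal{S}\vDash_{\mathfrak{C}}S$ means every algebraic model over an algebra in $\mathfrak{C}$ validating all of $\mathcal{S}$ validates $S$. *)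

theory Defs
  imports "HOL-Algebra.Lattice" "HOL-Library.Multiset"
begin

text \<open>The same seven names index both the additional rules and the algebraic properties.\<close>

datatype feature = N | H | D | R | L | Fa | Fu

datatype 'v fm =
    Atom 'v
  | Top
  | Bot
  | And "'v fm" "'v fm"  (infixr \<open>\<^bold>\<and>\<close> 75)
  | Or "'v fm" "'v fm"  (infixr \<open>\<^bold>\<or>\<close> 74)
  | Imp "'v fm" "'v fm"  (infixr \<open>\<^bold>\<rightarrow>\<close> 73)
  | Nabla "'v fm"  (\<open>\<^bold>\<nabla> _\<close> [80] 80)
  | HImp "'v fm" "'v fm"  (infixr \<open>\<^bold>\<supset>\<close> 73)

primrec supset_free :: "'v fm \<Rightarrow> bool" where
  "supset_free (Atom p) \<longleftrightarrow> True"
| "supset_free Top \<longleftrightarrow> True"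
| "supset_free Bot \<longleftrightarrow> True"
| "supset_free (A \<^bold>\<and> B) \<longleftrightarrow> supset_free A \<and> supset_free B"
| "supset_free (A \<^bold>\<or> B) \<longleftrightarrow> supset_free A \<and> supset_free B"
| "supset_free (A \<^bold>\<rightarrow> B) \<longleftrightarrow> supset_free A \<and> supset_free B"
| "supset_free (\<^bold>\<nabla> A) \<longleftrightarrow> supset_free A"
| "supset_free (A \<^bold>\<supset> B) \<longleftrightarrow> False"

text \<open>The connective \<open>\<^bold>\<supset>\<close> belongs to the language only in the presence of \<^const>\<open>H\<close>.\<close>

definition formulas :: "feature set \<Rightarrow> 'v fm set" where
  "formulas C = {A. H \<in> C \<or> supset_free A}"

datatype 'v sequent =
  Sequent (ant: "'v fm multiset") (suc: "'v fm multiset")  (infix \<open>\<Rrightarrow>\<close> 55)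

definition sequents :: "feature set \<Rightarrow> 'v sequent set" where
  "sequents C = {s. set_mset (ant s) \<subseteq> formulas C \<and> set_mset (suc s) \<subseteq> formulas C
                    \<and> size (suc s) \<le> 1}"

text \<open>\<open>stl_rule C ps s\<close>: the sequent \<open>s\<close> follows from the list of premises \<open>ps\<close> by one rule of
  \<open>STL(C)\<close>. The restrictions to the language and to at most one succedent formula are imposed
  on derivations below.\<close>

inductive stl_rule :: "feature set \<Rightarrow> 'v sequent list \<Rightarrow> 'v sequent \<Rightarrow> bool"
  for C :: "feature set" where
  Ax: "stl_rule C [] ({#A#} \<Rrightarrow> {#A#})"
| BotL: "stl_rule C [] ({#Bot#} \<Rrightarrow> {#})"
| TopR: "stl_rule C [] ({#} \<Rrightarrow> {#Top#})"
| WeakL: "stl_rule C [\<Gamma> \<Rrightarrow> \<Delta>] (\<Gamma> + {#A#} \<Rrightarrow> \<Delta>)"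
| WeakR: "stl_rule C [\<Gamma> \<Rrightarrow> {#}] (\<Gamma> \<Rrightarrow> {#A#})"
| Contr: "stl_rule C [\<Gamma> + {#A, A#} \<Rrightarrow> \<Delta>] (\<Gamma> + {#A#} \<Rrightarrow> \<Delta>)"
| Cut: "stl_rule C [\<Gamma> \<Rrightarrow> {#A#}, \<Theta> + {#A#} \<Rrightarrow> \<Delta>] (\<Theta> + \<Gamma> \<Rrightarrow> \<Delta>)"
| AndL1: "stl_rule C [\<Gamma> + {#A#} \<Rrightarrow> \<Delta>] (\<Gamma> + {#A \<^bold>\<and> B#} \<Rrightarrow> \<Delta>)"
| AndL2: "stl_rule C [\<Gamma> + {#B#} \<Rrightarrow> \<Delta>] (\<Gamma> + {#A \<^bold>\<and> B#} \<Rrightarrow> \<Delta>)"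
| AndR: "stl_rule C [\<Gamma> \<Rrightarrow> {#A#}, \<Gamma> \<Rrightarrow> {#B#}] (\<Gamma> \<Rrightarrow> {#A \<^bold>\<and> B#})"
| OrL: "stl_rule C [{#A#} \<Rrightarrow> \<Delta>, {#B#} \<Rrightarrow> \<Delta>] ({#A \<^bold>\<or> B#} \<Rrightarrow> \<Delta>)"
| OrR1: "stl_rule C [\<Gamma> \<Rrightarrow> {#A#}] (\<Gamma> \<Rrightarrow> {#A \<^bold>\<or> B#})"
| OrR2: "stl_rule C [\<Gamma> \<Rrightarrow> {#B#}] (\<Gamma> \<Rrightarrow> {#A \<^bold>\<or> B#})"
| NablaLR: "stl_rule C [{#A#} \<Rrightarrow> {#B#}] ({#\<^bold>\<nabla> A#} \<Rrightarrow> {#\<^bold>\<nabla> B#})"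
| ImpL: "stl_rule C [\<Gamma> \<Rrightarrow> {#A#}, \<Gamma> + {#B#} \<Rrightarrow> \<Delta>] (\<Gamma> + {#\<^bold>\<nabla> (A \<^bold>\<rightarrow> B)#} \<Rrightarrow> \<Delta>)"
| ImpR: "stl_rule C [image_mset Nabla \<Gamma> + {#A#} \<Rrightarrow> {#B#}] (\<Gamma> \<Rrightarrow> {#A \<^bold>\<rightarrow> B#})"
| RuleR: "R \<in> C \<Longrightarrow> stl_rule C [\<Gamma> \<Rrightarrow> {#A#}] (\<Gamma> \<Rrightarrow> {#\<^bold>\<nabla> A#})"
| RuleL: "L \<in> C \<Longrightarrow> stl_rule C [\<Gamma> + {#A#} \<Rrightarrow> \<Delta>] (\<Gamma> + {#\<^bold>\<nabla> A#} \<Rrightarrow> \<Delta>)"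
| RuleD: "D \<in> C \<Longrightarrow>
    stl_rule C [\<Gamma> + {#A#} \<Rrightarrow> \<Delta>, \<Gamma> + {#B#} \<Rrightarrow> \<Delta>] (\<Gamma> + {#A \<^bold>\<or> B#} \<Rrightarrow> \<Delta>)"
| RuleN: "N \<in> C \<Longrightarrow> stl_rule C [\<Gamma> \<Rrightarrow> \<Delta>] (image_mset Nabla \<Gamma> \<Rrightarrow> image_mset Nabla \<Delta>)"
| RuleFa: "Fa \<in> C \<Longrightarrow> stl_rule C [\<Gamma> + {#A#} \<Rrightarrow> {#B#}] (\<Gamma> \<Rrightarrow> {#\<^bold>\<nabla> (A \<^bold>\<rightarrow> B)#})"
| RuleFu: "Fu \<in> C \<Longrightarrow>
    stl_rule C [image_mset Nabla \<Gamma> \<Rrightarrow> {#A#}, image_mset Nabla \<Gamma> + {#B#} \<Rrightarrow> image_mset Nabla \<Delta>]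
      (\<Gamma> + {#A \<^bold>\<rightarrow> B#} \<Rrightarrow> \<Delta>)"
| RuleHL: "H \<in> C \<Longrightarrow>
    stl_rule C [\<Gamma> \<Rrightarrow> {#A#}, \<Gamma> + {#B#} \<Rrightarrow> \<Delta>] (\<Gamma> + {#A \<^bold>\<supset> B#} \<Rrightarrow> \<Delta>)"
| RuleHR: "H \<in> C \<Longrightarrow> stl_rule C [\<Gamma> + {#A#} \<Rrightarrow> {#B#}] (\<Gamma> \<Rrightarrow> {#A \<^bold>\<supset> B#})"

inductive derivable :: "feature set \<Rightarrow> 'v sequent set \<Rightarrow> 'v sequent \<Rightarrow> bool"
  for C :: "feature set" and S :: "'v sequent set" where
  premise: "s \<in> S \<Longrightarrow> s \<in> sequents C \<Longrightarrow> derivable C S s"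
| step: "stl_rule C ps s \<Longrightarrow> (\<And>p. p \<in> set ps \<Longrightarrow> derivable C S p) \<Longrightarrow> s \<in> sequents C
    \<Longrightarrow> derivable C S s"

record 'a nabla_structure = "'a gorder" +
  nabla :: "'a \<Rightarrow> 'a"  (\<open>\<nabla>\<index> _\<close> [81] 80)
  arrow :: "'a \<Rightarrow> 'a \<Rightarrow> 'a"  (infixr \<open>\<rightharpoondown>\<index>\<close> 60)

locale nabla_algebra = bounded_lattice A for A :: "('a, 'm) nabla_structure_scheme" (structure) +
  assumes nabla_closed: "a \<in> carrier A \<Longrightarrow> \<nabla> a \<in> carrier A"
    and arrow_closed: "a \<in> carrier A \<Longrightarrow> b \<in> carrier A \<Longrightarrow> a \<rightharpoondown> b \<in> carrier A"
    and adjunction: "a \<in> carrier A \<Longrightarrow> b \<in> carrier A \<Longrightarrow> c \<in> carrier A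
      \<Longrightarrow> \<nabla> c \<sqinter> a \<sqsubseteq> b \<longleftrightarrow> c \<sqsubseteq> a \<rightharpoondown> b"

definition is_heyting_imp :: "('a, 'm) gorder_scheme \<Rightarrow> 'a \<Rightarrow> 'a \<Rightarrow> 'a \<Rightarrow> bool" where
  "is_heyting_imp A a b d \<longleftrightarrow>
    d \<in> carrier A \<and> (\<forall>c\<in>carrier A. c \<sqinter>\<^bsub>A\<^esub> a \<sqsubseteq>\<^bsub>A\<^esub> b \<longleftrightarrow> c \<sqsubseteq>\<^bsub>A\<^esub> d)"

definition heyting_imp :: "('a, 'm) gorder_scheme \<Rightarrow> 'a \<Rightarrow> 'a \<Rightarrow> 'a" where
  "heyting_imp A a b = (THE d. is_heyting_imp A a b d)"

fun has_property :: "('a, 'm) nabla_structure_scheme \<Rightarrow> feature \<Rightarrow> bool" where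
  "has_property A N \<longleftrightarrow> \<nabla>\<^bsub>A\<^esub> \<top>\<^bsub>A\<^esub> = \<top>\<^bsub>A\<^esub> \<and>
    (\<forall>a\<in>carrier A. \<forall>b\<in>carrier A. \<nabla>\<^bsub>A\<^esub> (a \<sqinter>\<^bsub>A\<^esub> b) = (\<nabla>\<^bsub>A\<^esub> a) \<sqinter>\<^bsub>A\<^esub> (\<nabla>\<^bsub>A\<^esub> b))"
| "has_property A H \<longleftrightarrow> (\<forall>a\<in>carrier A. \<forall>b\<in>carrier A. \<exists>d. is_heyting_imp A a b d)"
| "has_property A D \<longleftrightarrow> (\<forall>a\<in>carrier A. \<forall>b\<in>carrier A. \<forall>c\<in>carrier A.
    a \<sqinter>\<^bsub>A\<^esub> (b \<squnion>\<^bsub>A\<^esub> c) = (a \<sqinter>\<^bsub>A\<^esub> b) \<squnion>\<^bsub>A\<^esub> (a \<sqinter>\<^bsub>A\<^esub> c))"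
| "has_property A R \<longleftrightarrow> (\<forall>a\<in>carrier A. a \<sqsubseteq>\<^bsub>A\<^esub> \<nabla>\<^bsub>A\<^esub> a)"
| "has_property A L \<longleftrightarrow> (\<forall>a\<in>carrier A. \<nabla>\<^bsub>A\<^esub> a \<sqsubseteq>\<^bsub>A\<^esub> a)"
| "has_property A Fa \<longleftrightarrow> (\<lambda>a. \<nabla>\<^bsub>A\<^esub> a) ` carrier A = carrier A"
| "has_property A Fu \<longleftrightarrow> (\<lambda>a. \<top>\<^bsub>A\<^esub> \<rightharpoondown>\<^bsub>A\<^esub> a) ` carrier A = carrier A"

definition \<V> :: "feature set \<Rightarrow> 'a nabla_structure set" where
  "\<V> C = {A. nabla_algebra A \<and> (\<forall>P\<in>C. has_property A P)}"

text \<open>Only the values of a valuation on the formulas of the language are constrained.\<close>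

definition valuation :: "feature set \<Rightarrow> 'a nabla_structure \<Rightarrow> ('v fm \<Rightarrow> 'a) \<Rightarrow> bool" where
  "valuation C A V \<longleftrightarrow>
     V ` formulas C \<subseteq> carrier A \<and>
     V Top = \<top>\<^bsub>A\<^esub> \<and> V Bot = \<bottom>\<^bsub>A\<^esub> \<and>
     (\<forall>F\<in>formulas C. V (\<^bold>\<nabla> F) = \<nabla>\<^bsub>A\<^esub> (V F)) \<and>
     (\<forall>F\<in>formulas C. \<forall>G\<in>formulas C.
        V (F \<^bold>\<and> G) = V F \<sqinter>\<^bsub>A\<^esub> V G \<and>
        V (F \<^bold>\<or> G) = V F \<squnion>\<^bsub>A\<^esub> V G \<and>
        V (F \<^bold>\<rightarrow> G) = V F \<rightharpoondown>\<^bsub>A\<^esub> V G \<and>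
        (H \<in> C \<longrightarrow> V (F \<^bold>\<supset> G) = heyting_imp A (V F) (V G)))"

text \<open>In a bounded lattice, the library's infimum (supremum) of the empty set is the top
  (bottom) element, so the empty antecedent and succedent are read as \<open>1\<close> and \<open>0\<close>.\<close>

definition validates :: "'a nabla_structure \<Rightarrow> ('v fm \<Rightarrow> 'a) \<Rightarrow> 'v sequent \<Rightarrow> bool" where
  "validates A V s \<longleftrightarrow>
     (\<Sqinter>\<^bsub>A\<^esub> (V ` set_mset (ant s))) \<sqsubseteq>\<^bsub>A\<^esub> (\<Squnion>\<^bsub>A\<^esub> (V ` set_mset (suc s)))"

text \<open>Consequence over \<open>\<V> C\<close>, the algebras ranging over all those whose carrier is a subset of
  the type \<open>'a\<close>.\<close>

definition entails :: "'a itself \<Rightarrow> feature set \<Rightarrow> 'v sequent set \<Rightarrow> 'v sequent \<Rightarrow> bool" where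
  "entails (_ :: 'a itself) C S s \<longleftrightarrow>
     (\<forall>(A :: 'a nabla_structure) V. A \<in> \<V> C \<longrightarrow> valuation C A V \<longrightarrow>
        (\<forall>t\<in>S. validates A V t) \<longrightarrow> validates A V s)"

end

theory Submission
  imports Defs
begin

text \<open>Soundness: a sequent holds in a model iff every element below all of its antecedent is below
  its succedent. In this form each rule follows from the defining property of its connective;
  for \<open>Fa\<close> one writes the element as \<open>\<nabla>d\<close>, for \<open>Fu\<close> one writes the succedent as \<open>1 \<rightarrow> d\<close>.

  Completeness: the formulas modulo interderivability from \<open>S\<close> form a \<open>\<nabla>\<close>-algebra in which exactly
  the derivable sequents hold. The rule \<open>Fa\<close> makes \<open>A\<close> equivalent to \<open>\<nabla>(\<top> \<rightarrow> A)\<close> and \<open>Fu\<close> makes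
  it equivalent to \<open>\<top> \<rightarrow> \<nabla>A\<close>, which gives the two surjectivity properties.\<close>

section \<open>The language\<close>

text \<open>With \<open>H\<close> in \<open>C\<close> every formula belongs to the language, and
  otherwise no formula containing \<supset> does; this is why the clause for \<open>HImp\<close>
  collapses to a condition on \<open>C\<close>.\<close>

lemma formulas_simps [simp]:
  "Top \<in> formulas C" "Bot \<in> formulas C"
  "A \<^bold>\<and> B \<in> formulas C \<longleftrightarrow> A \<in> formulas C \<and> B \<in> formulas C"
  "A \<^bold>\<or> B \<in> formulas C \<longleftrightarrow> A \<in> formulas C \<and> B \<in> formulas C"
  "A \<^bold>\<rightarrow> B \<in> formulas C \<longleftrightarrow> A \<in> formulas C \<and> B \<in> formulas C"
  "\<^bold>\<nabla> A \<in> formulas C \<longleftrightarrow> A \<in> formulas C"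
  "A \<^bold>\<supset> B \<in> formulas C \<longleftrightarrow> H \<in> C"
  by (auto simp: formulas_def)

lemma formulas_H: "H \<in> C \<Longrightarrow> A \<in> formulas C"
  by (simp add: formulas_def)

lemma sequents_iff [simp]:
  "(\<Gamma> \<Rrightarrow> \<Delta>) \<in> sequents C \<longleftrightarrow>
    set_mset \<Gamma> \<subseteq> formulas C \<and> set_mset \<Delta> \<subseteq> formulas C \<and> size \<Delta> \<le> 1"
  by (simp add: sequents_def)

lemma derivable_in_sequents: "derivable C S s \<Longrightarrow> s \<in> sequents C"
  by (auto elim: derivable.cases)

section \<open>Soundness\<close>

context bounded_lattice
begin

text \<open>Every carrier element is a lower bound of the empty set, so \<top> is its infimum; this
  is how an empty antecedent comes to mean \<top>.\<close>

lemma finite_inf_greatest_bounded: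
  assumes "finite X" "X \<subseteq> carrier L"
  shows "greatest L (\<Sqinter> X) (Lower L X)"
proof (cases "X = {}")
  case True
  have "greatest L \<top> (Lower L {})" by (simp add: top_greatest)
  \<comment> \<open>The infimum is a chosen greatest lower bound, so exhibiting one of them
    suffices.\<close>
  then show ?thesis unfolding True Lattice.inf_def by (rule someI)
qed (use assms finite_inf_greatest in blast)

lemma finite_sup_least_bounded:
  assumes "finite X" "X \<subseteq> carrier L"
  shows "least L (\<Squnion> X) (Upper L X)"
proof (cases "X = {}")
  case True
  have "least L \<bottom> (Upper L {})" by (simp add: bottom_least)
  then show ?thesis unfolding True Lattice.sup_def by (rule someI)
qed (use assms finite_sup_least in blast)

lemma le_finite_inf_iff:
  assumes "finite X" "X \<subseteq> carrier L" "c \<in> carrier L"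
  shows "c \<sqsubseteq> \<Sqinter> X \<longleftrightarrow> (\<forall>x\<in>X. c \<sqsubseteq> x)"
proof -
  note g = finite_inf_greatest_bounded[OF assms(1,2)]
  show ?thesis
  proof
    assume c: "c \<sqsubseteq> \<Sqinter> X"
    show "\<forall>x\<in>X. c \<sqsubseteq> x"
    proof
      fix x assume x: "x \<in> X"
      show "c \<sqsubseteq> x"
        using le_trans[OF c greatest_Lower_below[OF g x assms(2)] assms(3) greatest_closed[OF g]] x
          assms(2) by blast
    qed
  next
    assume "\<forall>x\<in>X. c \<sqsubseteq> x"
    then show "c \<sqsubseteq> \<Sqinter> X"
      using assms by (intro greatest_le[OF g] Lower_memI) auto
  qed
qed

lemma sup_singleton [simp]: "x \<in> carrier L \<Longrightarrow> \<Squnion>{x} = x"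
  using weak_sup_of_singleton eq_is_equal by simp

lemma sup_empty [simp]: "\<Squnion>{} = \<bottom>"
  using finite_sup_least_bounded[of "{}"] bottom_least by (auto intro: least_unique)

lemma le_meet_iff:
  "x \<in> carrier L \<Longrightarrow> y \<in> carrier L \<Longrightarrow> c \<in> carrier L \<Longrightarrow> c \<sqsubseteq> x \<sqinter> y \<longleftrightarrow> c \<sqsubseteq> x \<and> c \<sqsubseteq> y"
  by (meson le_trans meet_closed meet_le meet_left meet_right)

lemma join_le_iff:
  "x \<in> carrier L \<Longrightarrow> y \<in> carrier L \<Longrightarrow> c \<in> carrier L \<Longrightarrow> x \<squnion> y \<sqsubseteq> c \<longleftrightarrow> x \<sqsubseteq> c \<and> y \<sqsubseteq> c"
  by (meson le_trans join_closed join_le join_left join_right)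

end

text \<open>Two elements with the residuation property lie below each other, so antisymmetry gives
  the uniqueness that the definite description asks for.\<close>

lemma (in partial_order) heyting_imp_eq:
  assumes "is_heyting_imp L a b d"
  shows "heyting_imp L a b = d"
  unfolding heyting_imp_def
proof (rule the_equality)
  fix e assume e: "is_heyting_imp L a b e"
  have "d \<in> carrier L" "e \<in> carrier L" using assms e by (auto simp: is_heyting_imp_def)
  moreover have "e \<sqsubseteq> d" "d \<sqsubseteq> e" using calculation assms e by (auto simp: is_heyting_imp_def)
  ultimately show "e = d" by blast
qed (rule assms)

section \<open>Consequences of the adjunction in a \<nabla>-algebra\<close>

context nabla_algebra
begin

text \<open>With first argument \<top> the adjunction makes \<nabla> left adjoint to b \<mapsto>
  \<open>\<top> \<rightharpoondown> b\<close>, and left adjoints are monotone. The proof starts from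
  the unit \<open>b \<sqsubseteq> \<top> \<rightharpoondown> \<nabla> b\<close>.\<close>

lemma nabla_mono:
  assumes "a \<in> carrier A" "b \<in> carrier A" "a \<sqsubseteq> b"
  shows "\<nabla> a \<sqsubseteq> \<nabla> b"
proof -
  have nb: "\<nabla> b \<in> carrier A" "\<top> \<in> carrier A" using assms nabla_closed by auto
  have "\<nabla> b \<sqinter> \<top> \<sqsubseteq> \<nabla> b" using nb by (simp add: meet_left)
  then have "b \<sqsubseteq> \<top> \<rightharpoondown> \<nabla> b" using adjunction assms nb by blast
  then have "a \<sqsubseteq> \<top> \<rightharpoondown> \<nabla> b" using le_trans[of a b "\<top> \<rightharpoondown> \<nabla> b"] assms arrow_closed nb by simp
  then have "\<nabla> a \<sqinter> \<top> \<sqsubseteq> \<nabla> b" using adjunction assms nb by blast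
  moreover have "\<nabla> a \<sqsubseteq> \<nabla> a \<sqinter> \<top>" using assms nabla_closed by (simp add: le_meet_iff)
  ultimately show ?thesis
    using le_trans[of "\<nabla> a" "\<nabla> a \<sqinter> \<top>" "\<nabla> b"] assms(1) nabla_closed nb by simp
qed

text \<open>A left adjoint preserves the least element: it suffices to transpose
  \<open>\<bottom> \<sqsubseteq> \<top> \<rightharpoondown> \<bottom>\<close>.\<close>

lemma nabla_bottom: "\<nabla> \<bottom> = \<bottom>"
proof -
  have c: "\<bottom> \<in> carrier A" "\<top> \<in> carrier A" "\<nabla> \<bottom> \<in> carrier A" using nabla_closed by auto
  have "\<bottom> \<sqsubseteq> \<top> \<rightharpoondown> \<bottom>" using arrow_closed by simp
  then have "\<nabla> \<bottom> \<sqinter> \<top> \<sqsubseteq> \<bottom>" using adjunction c by blast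
  moreover have "\<nabla> \<bottom> \<sqsubseteq> \<nabla> \<bottom> \<sqinter> \<top>" using c by (simp add: le_meet_iff)
  ultimately have "\<nabla> \<bottom> \<sqsubseteq> \<bottom>"
    using le_trans[of "\<nabla> \<bottom>" "\<nabla> \<bottom> \<sqinter> \<top>" \<bottom>] c by simp
  then show ?thesis using c by (blast intro: le_antisym)
qed

text \<open>Modus ponens for the arrow: transposing \<open>a \<rightharpoondown> b \<sqsubseteq> a
  \<rightharpoondown> b\<close> gives the counit \<open>\<nabla> (a \<rightharpoondown> b)
  \<sqinter> a \<sqsubseteq> b\<close>.\<close>

lemma nabla_arrow_elim:
  assumes "a \<in> carrier A" "b \<in> carrier A" "c \<in> carrier A"
    and "c \<sqsubseteq> \<nabla> (a \<rightharpoondown> b)" "c \<sqsubseteq> a"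
  shows "c \<sqsubseteq> b"
proof -
  have ab: "a \<rightharpoondown> b \<in> carrier A" using assms arrow_closed by blast
  then have "\<nabla> (a \<rightharpoondown> b) \<sqinter> a \<sqsubseteq> b" using adjunction[of a b "a \<rightharpoondown> b"] assms by simp
  moreover have "c \<sqsubseteq> \<nabla> (a \<rightharpoondown> b) \<sqinter> a" using ab assms nabla_closed by (simp add: le_meet_iff)
  ultimately show ?thesis
    using le_trans[of c "\<nabla> (a \<rightharpoondown> b) \<sqinter> a" b] assms ab nabla_closed by simp
qed

end

section \<open>Models and elementwise validity of sequents\<close>

locale nabla_model = nabla_algebra A for A :: "'a nabla_structure" (structure) +
  fixes C :: "feature set" and V :: "'v fm \<Rightarrow> 'a"
  assumes properties: "P \<in> C \<Longrightarrow> has_property A P"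
    and val: "valuation C A V"
begin

lemma V_closed [simp]: "F \<in> formulas C \<Longrightarrow> V F \<in> carrier A"
  using val by (auto simp: valuation_def)

lemma V_simps [simp]:
  "V Top = \<top>" "V Bot = \<bottom>"
  "F \<in> formulas C \<Longrightarrow> V (\<^bold>\<nabla> F) = \<nabla> (V F)"
  "F \<in> formulas C \<Longrightarrow> G \<in> formulas C \<Longrightarrow> V (F \<^bold>\<and> G) = V F \<sqinter> V G"
  "F \<in> formulas C \<Longrightarrow> G \<in> formulas C \<Longrightarrow> V (F \<^bold>\<or> G) = V F \<squnion> V G"
  "F \<in> formulas C \<Longrightarrow> G \<in> formulas C \<Longrightarrow> V (F \<^bold>\<rightarrow> G) = V F \<rightharpoondown> V G"
  using val by (auto simp: valuation_def)

text \<open>Property \<open>H\<close> supplies some residual of \<open>V F\<close> and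
  \<open>V G\<close>; by uniqueness it is the value that the valuation prescribes.\<close>

lemma le_V_HImp_iff:
  assumes "H \<in> C" "c \<in> carrier A"
  shows "c \<sqsubseteq> V (F \<^bold>\<supset> G) \<longleftrightarrow> c \<sqinter> V F \<sqsubseteq> V G"
proof -
  have FG: "F \<in> formulas C" "G \<in> formulas C" using assms formulas_H by auto
  obtain d where d: "is_heyting_imp A (V F) (V G) d"
    using properties[OF assms(1)] V_closed[OF FG(1)] V_closed[OF FG(2)]
    unfolding has_property.simps by blast
  have "V (F \<^bold>\<supset> G) = d"
    using val FG assms(1) heyting_imp_eq[OF d] by (auto simp: valuation_def)
  then show ?thesis using d assms(2) by (auto simp: is_heyting_imp_def)
qed

abbreviation below :: "'a \<Rightarrow> 'v fm multiset \<Rightarrow> bool" where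
  "below c \<Gamma> \<equiv> \<forall>F\<in>#\<Gamma>. c \<sqsubseteq> V F"

abbreviation join_of :: "'v fm multiset \<Rightarrow> 'a" where
  "join_of \<Delta> \<equiv> \<Squnion> (V ` set_mset \<Delta>)"

lemma join_of_closed [simp]: "set_mset \<Delta> \<subseteq> formulas C \<Longrightarrow> join_of \<Delta> \<in> carrier A"
  using finite_sup_least_bounded[of "V ` set_mset \<Delta>"] by (force intro: least_closed)

text \<open>The elements below all antecedent values are those below their infimum. Transitivity
  gives one direction, and taking \<open>c\<close> to be the infimum itself gives the other.\<close>

lemma validates_iff:
  assumes "set_mset \<Gamma> \<subseteq> formulas C" "set_mset \<Delta> \<subseteq> formulas C"
  shows "validates A V (\<Gamma> \<Rrightarrow> \<Delta>) \<longleftrightarrow>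
    (\<forall>c\<in>carrier A. below c \<Gamma> \<longrightarrow> c \<sqsubseteq> join_of \<Delta>)"
proof -
  let ?m = "\<Sqinter> (V ` set_mset \<Gamma>)"
  have sub: "finite (V ` set_mset \<Gamma>)" "V ` set_mset \<Gamma> \<subseteq> carrier A" using assms by auto
  have m: "?m \<in> carrier A" using finite_inf_greatest_bounded[OF sub] by (rule greatest_closed)
  have iff: "c \<sqsubseteq> ?m \<longleftrightarrow> below c \<Gamma>" if "c \<in> carrier A" for c
    using le_finite_inf_iff[OF sub that] by simp
  show ?thesis
    unfolding validates_def sequent.sel
  proof
    assume "?m \<sqsubseteq> join_of \<Delta>"
    then show "\<forall>c\<in>carrier A. below c \<Gamma> \<longrightarrow> c \<sqsubseteq> join_of \<Delta>"
      using iff le_trans[OF _ _ _ m join_of_closed[OF assms(2)]] by blast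
  qed (use iff m in \<open>metis le_refl\<close>)
qed

lemma below_mono:
  assumes "set_mset \<Gamma> \<subseteq> formulas C" "c \<in> carrier A" "d \<in> carrier A" "d \<sqsubseteq> c" "below c \<Gamma>"
  shows "below d \<Gamma>"
  using assms le_trans[OF assms(4) _ assms(3,2)] by (auto simp: subset_iff)

lemma below_nabla:
  assumes "set_mset \<Gamma> \<subseteq> formulas C" "c \<in> carrier A" "below c \<Gamma>"
  shows "below (\<nabla> c) (image_mset Nabla \<Gamma>)"
  using assms nabla_mono by (auto simp: subset_iff)

text \<open>A converse to \<open>below_nabla\<close> under property \<open>N\<close>: the finite
  meet \<open>m\<close> of the values of \<Gamma> is preserved by \<nabla>, and the empty meet is
  covered by \<nabla>\<top> = \<top>.\<close>

lemma nabla_cover: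
  assumes "N \<in> C" "set_mset \<Gamma> \<subseteq> formulas C" "c \<in> carrier A" "below c (image_mset Nabla \<Gamma>)"
  shows "\<exists>m\<in>carrier A. below m \<Gamma> \<and> c \<sqsubseteq> \<nabla> m"
  using assms(2,4)
proof (induction \<Gamma>)
  case empty
  have "\<nabla> \<top> = \<top>" using properties[OF assms(1)] by simp
  then show ?case using assms(3) by (intro bexI[of _ \<top>]) auto
next
  case (add F \<Gamma>)
  then obtain m where m: "m \<in> carrier A" "below m \<Gamma>" "c \<sqsubseteq> \<nabla> m" by auto
  have F: "F \<in> formulas C" "set_mset \<Gamma> \<subseteq> formulas C" "c \<sqsubseteq> \<nabla> (V F)" using add.prems by auto
  have eq: "\<nabla> (m \<sqinter> V F) = \<nabla> m \<sqinter> \<nabla> (V F)" using properties[OF assms(1)] m F by simp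
  have "c \<sqsubseteq> \<nabla> (m \<sqinter> V F)"
    unfolding eq using m F assms(3) nabla_closed by (simp add: le_meet_iff)
  moreover have "below (m \<sqinter> V F) \<Gamma>"
    using below_mono[of \<Gamma> m "m \<sqinter> V F"] m F by (simp add: meet_left)
  moreover have "m \<sqinter> V F \<sqsubseteq> V F" using m F by (simp add: meet_right)
  ultimately show ?case using m F by (intro bexI[of _ "m \<sqinter> V F"]) auto
qed

text \<open>Only two shapes of succedent occur: a single formula, or the empty one, whose join
  \<bottom> is fixed by \<nabla>.\<close>

lemma join_of_nabla:
  assumes "set_mset \<Delta> \<subseteq> formulas C" "size \<Delta> \<le> 1"
  shows "join_of (image_mset Nabla \<Delta>) = \<nabla> (join_of \<Delta>)"
  using assms nabla_bottom nabla_closed by (cases \<Delta>) auto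

text \<open>Given \<open>c\<close> below the antecedent of the conclusion, the premises are applied
  to a suitable element: to \<open>c\<close> itself, to its meet with \<open>V F\<close> when a
  premise assumes a further formula \<open>F\<close> that \<open>c\<close> need not lie below, to
  \<open>\<nabla> c\<close> when the context of a premise is under \<nabla>, and to
  \<open>V F\<close> when the premise is \<open>F\<close> without context. Rule \<open>N\<close>
  takes its element from \<open>nabla_cover\<close>.\<close>

lemma stl_rule_sound:
  assumes "stl_rule C ps s" "s \<in> sequents C"
    and seq: "set ps \<subseteq> sequents C" and ps: "\<And>p. p \<in> set ps \<Longrightarrow> validates A V p"
  shows "validates A V s"
proof -
  \<comment> \<open>\<open>prem\<close> and \<open>concl\<close> translate the premises and the goal
    by \<open>validates_iff\<close> once and for all, so that each case is about inequalities
    only.\<close>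
  have prem: "c \<sqsubseteq> join_of \<Delta>"
    if "(\<Gamma> \<Rrightarrow> \<Delta>) \<in> set ps" "c \<in> carrier A" "below c \<Gamma>" for \<Gamma> \<Delta> c
  proof -
    have "(\<Gamma> \<Rrightarrow> \<Delta>) \<in> sequents C" using that seq by blast
    then show ?thesis using ps[OF that(1)] that validates_iff by simp
  qed
  have concl: ?thesis
    if "s = (\<Gamma> \<Rrightarrow> \<Delta>)" "\<And>c. c \<in> carrier A \<Longrightarrow> below c \<Gamma> \<Longrightarrow> c \<sqsubseteq> join_of \<Delta>" for \<Gamma> \<Delta>
    using that assms(2) validates_iff[of \<Gamma> \<Delta>] by simp
  from assms(1) show ?thesis
  proof cases
    case (Ax F)
    have F: "F \<in> formulas C"
      using seq assms(2) Ax by (auto simp: formulas_H)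
    show ?thesis
    proof (rule concl[OF Ax(2)])
      fix c assume c: "c \<in> carrier A" "below c {#F#}"
      then show "c \<sqsubseteq> join_of {#F#}" using F by simp
    qed
  next
    case BotL
    show ?thesis
    proof (rule concl[OF BotL(2)])
      fix c assume c: "c \<in> carrier A" "below c {#Bot#}"
      then show "c \<sqsubseteq> join_of {#}" by simp
    qed
  next
    case TopR
    show ?thesis
    proof (rule concl[OF TopR(2)])
      fix c assume c: "c \<in> carrier A" "below c {#}"
      then show "c \<sqsubseteq> join_of {#Top#}" by simp
    qed
  next
    case (WeakL \<Gamma> \<Delta> F)
    show ?thesis
    proof (rule concl[OF WeakL(2)])
      fix c assume c: "c \<in> carrier A" "below c (\<Gamma> + {#F#})"
      then show "c \<sqsubseteq> join_of \<Delta>" using prem[of "\<Gamma>" "\<Delta>" c] WeakL by simp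
    qed
  next
    case (WeakR \<Gamma> F)
    have F: "F \<in> formulas C"
      using seq assms(2) WeakR by (auto simp: formulas_H)
    show ?thesis
    proof (rule concl[OF WeakR(2)])
      fix c assume c: "c \<in> carrier A" "below c \<Gamma>"
      \<comment> \<open>The empty succedent of the premise has join \<bottom>.\<close>
      have "c \<sqsubseteq> \<bottom>" using prem[of "\<Gamma>" "{#}" c] WeakR c by simp
      then show "c \<sqsubseteq> join_of {#F#}" using le_trans[of c \<bottom> "V F"] c F by simp
    qed
  next
    case (Contr \<Gamma> F \<Delta>)
    show ?thesis
    proof (rule concl[OF Contr(2)])
      fix c assume c: "c \<in> carrier A" "below c (\<Gamma> + {#F#})"
      then show "c \<sqsubseteq> join_of \<Delta>" using prem[of "\<Gamma> + {#F, F#}" "\<Delta>" c] Contr by simp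
    qed
  next
    case (Cut \<Gamma> F \<Theta> \<Delta>)
    show ?thesis
    proof (rule concl[OF Cut(2)])
      fix c assume c: "c \<in> carrier A" "below c (\<Theta> + \<Gamma>)"
      \<comment> \<open>The cut formula is absent from the conclusion, so its membership in the
        language comes from the premises.\<close>
      have "F \<in> formulas C" using seq Cut by auto
      then have "c \<sqsubseteq> V F" using prem[of "\<Gamma>" "{#F#}" c] Cut c by simp
      then show "c \<sqsubseteq> join_of \<Delta>" using prem[of "\<Theta> + {#F#}" "\<Delta>" c] Cut c by auto
    qed
  next
    case (AndL1 \<Gamma> F \<Delta> G)
    have F: "F \<in> formulas C" "G \<in> formulas C"
      using seq assms(2) AndL1 by (auto simp: formulas_H)
    show ?thesis
    proof (rule concl[OF AndL1(2)])
      fix c assume c: "c \<in> carrier A" "below c (\<Gamma> + {#F \<^bold>\<and> G#})"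
      then have "c \<sqsubseteq> V F" using F by (simp add: le_meet_iff)
      then show "c \<sqsubseteq> join_of \<Delta>" using prem[of "\<Gamma> + {#F#}" "\<Delta>" c] AndL1 c by simp
    qed
  next
    case (AndL2 \<Gamma> G \<Delta> F)
    have F: "F \<in> formulas C" "G \<in> formulas C"
      using seq assms(2) AndL2 by (auto simp: formulas_H)
    show ?thesis
    proof (rule concl[OF AndL2(2)])
      fix c assume c: "c \<in> carrier A" "below c (\<Gamma> + {#F \<^bold>\<and> G#})"
      then have "c \<sqsubseteq> V G" using F by (simp add: le_meet_iff)
      then show "c \<sqsubseteq> join_of \<Delta>" using prem[of "\<Gamma> + {#G#}" "\<Delta>" c] AndL2 c by simp
    qed
  next
    case (AndR \<Gamma> F G)
    have F: "F \<in> formulas C" "G \<in> formulas C"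
      using seq assms(2) AndR by (auto simp: formulas_H)
    show ?thesis
    proof (rule concl[OF AndR(2)])
      fix c assume c: "c \<in> carrier A" "below c \<Gamma>"
      have "c \<sqsubseteq> V F" "c \<sqsubseteq> V G"
        using prem[of "\<Gamma>" "{#F#}" c] prem[of "\<Gamma>" "{#G#}" c] AndR c F by auto
      then show "c \<sqsubseteq> join_of {#F \<^bold>\<and> G#}" using c F by (simp add: le_meet_iff)
    qed
  next
    case (OrL F \<Delta> G)
    have F: "F \<in> formulas C" "G \<in> formulas C" "set_mset \<Delta> \<subseteq> formulas C"
      using seq assms(2) OrL by (auto simp: formulas_H)
    show ?thesis
    proof (rule concl[OF OrL(2)])
      fix c assume c: "c \<in> carrier A" "below c ({#F \<^bold>\<or> G#})"
      \<comment> \<open>Without a context the premises can be tested at \<open>V F\<close> and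
        \<open>V G\<close> themselves, whose join lies above \<open>c\<close>.\<close>
      have "V F \<squnion> V G \<sqsubseteq> join_of \<Delta>"
        using prem[of "{#F#}" "\<Delta>" "V F"] prem[of "{#G#}" "\<Delta>" "V G"] OrL F by (simp add: join_le_iff)
      then show "c \<sqsubseteq> join_of \<Delta>" using le_trans[of c "V F \<squnion> V G" "join_of \<Delta>"] c F by simp
    qed
  next
    case (OrR1 \<Gamma> F G)
    have F: "F \<in> formulas C" "G \<in> formulas C"
      using seq assms(2) OrR1 by (auto simp: formulas_H)
    show ?thesis
    proof (rule concl[OF OrR1(2)])
      fix c assume c: "c \<in> carrier A" "below c \<Gamma>"
      have "c \<sqsubseteq> V F" using prem[of "\<Gamma>" "{#F#}" c] OrR1 c F by simp
      then show "c \<sqsubseteq> join_of {#F \<^bold>\<or> G#}"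
        using le_trans[of c "V F" "V F \<squnion> V G"] c F by (simp add: join_left)
    qed
  next
    case (OrR2 \<Gamma> G F)
    have F: "F \<in> formulas C" "G \<in> formulas C"
      using seq assms(2) OrR2 by (auto simp: formulas_H)
    show ?thesis
    proof (rule concl[OF OrR2(2)])
      fix c assume c: "c \<in> carrier A" "below c \<Gamma>"
      have "c \<sqsubseteq> V G" using prem[of "\<Gamma>" "{#G#}" c] OrR2 c F by simp
      then show "c \<sqsubseteq> join_of {#F \<^bold>\<or> G#}"
        using le_trans[of c "V G" "V F \<squnion> V G"] c F by (simp add: join_right)
    qed
  next
    case (NablaLR F G)
    have F: "F \<in> formulas C" "G \<in> formulas C"
      using seq assms(2) NablaLR by (auto simp: formulas_H)
    show ?thesis
    proof (rule concl[OF NablaLR(2)])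
      fix c assume c: "c \<in> carrier A" "below c ({#\<^bold>\<nabla> F#})"
      have "V F \<sqsubseteq> V G" using prem[of "{#F#}" "{#G#}" "V F"] NablaLR F by simp
      then have "\<nabla> (V F) \<sqsubseteq> \<nabla> (V G)" using nabla_mono F by simp
      then show "c \<sqsubseteq> join_of {#\<^bold>\<nabla> G#}"
        using le_trans[of c "\<nabla> (V F)" "\<nabla> (V G)"] c F nabla_closed by simp
    qed
  next
    case (ImpL \<Gamma> F G \<Delta>)
    have F: "F \<in> formulas C" "G \<in> formulas C"
      using seq assms(2) ImpL by (auto simp: formulas_H)
    show ?thesis
    proof (rule concl[OF ImpL(2)])
      fix c assume c: "c \<in> carrier A" "below c (\<Gamma> + {#\<^bold>\<nabla> (F \<^bold>\<rightarrow> G)#})"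
      have "c \<sqsubseteq> V F" using prem[of "\<Gamma>" "{#F#}" c] ImpL c F by simp
      moreover have "c \<sqsubseteq> \<nabla> (V F \<rightharpoondown> V G)" using c F by simp
      ultimately have "c \<sqsubseteq> V G" using nabla_arrow_elim c F by (meson V_closed)
      then show "c \<sqsubseteq> join_of \<Delta>" using prem[of "\<Gamma> + {#G#}" "\<Delta>" c] ImpL c by simp
    qed
  next
    case (ImpR \<Gamma> F G)
    have F: "F \<in> formulas C" "G \<in> formulas C" "set_mset \<Gamma> \<subseteq> formulas C"
      using seq assms(2) ImpR by (auto simp: formulas_H)
    show ?thesis
    proof (rule concl[OF ImpR(2)])
      fix c assume c: "c \<in> carrier A" "below c \<Gamma>"
      have N\<Gamma>: "set_mset (image_mset Nabla \<Gamma>) \<subseteq> formulas C" using F by auto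
      \<comment> \<open>By the adjunction the goal amounts to
        \<open>\<nabla> c \<sqinter> V F \<sqsubseteq> V G\<close>, so the premise is tested at this
        meet.\<close>
      have m: "\<nabla> c \<in> carrier A" "\<nabla> c \<sqinter> V F \<in> carrier A" using c F nabla_closed by auto
      have "\<nabla> c \<sqinter> V F \<sqsubseteq> \<nabla> c" "\<nabla> c \<sqinter> V F \<sqsubseteq> V F" using m F by (simp_all add: meet_left meet_right)
      moreover have "below (\<nabla> c) (image_mset Nabla \<Gamma>)" using below_nabla[OF F(3) c] .
      ultimately have "\<nabla> c \<sqinter> V F \<sqsubseteq> V G"
        using below_mono[OF N\<Gamma> m] prem[of "image_mset Nabla \<Gamma> + {#F#}" "{#G#}" "\<nabla> c \<sqinter> V F"] ImpR m F by simp
      then show "c \<sqsubseteq> join_of {#F \<^bold>\<rightarrow> G#}" using adjunction c F arrow_closed by simp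
    qed
  next
    case (RuleR \<Gamma> F)
    have F: "F \<in> formulas C"
      using seq assms(2) RuleR by (auto simp: formulas_H)
    show ?thesis
    proof (rule concl[OF RuleR(2)])
      fix c assume c: "c \<in> carrier A" "below c \<Gamma>"
      have "c \<sqsubseteq> V F" using prem[of "\<Gamma>" "{#F#}" c] RuleR c F by simp
      moreover have "V F \<sqsubseteq> \<nabla> (V F)" using properties[OF \<open>R \<in> C\<close>] F by simp
      ultimately show "c \<sqsubseteq> join_of {#\<^bold>\<nabla> F#}"
        using le_trans[of c "V F" "\<nabla> (V F)"] c F nabla_closed by simp
    qed
  next
    case (RuleL \<Gamma> F \<Delta>)
    have F: "F \<in> formulas C"
      using seq assms(2) RuleL by (auto simp: formulas_H)
    show ?thesis
    proof (rule concl[OF RuleL(2)])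
      fix c assume c: "c \<in> carrier A" "below c (\<Gamma> + {#\<^bold>\<nabla> F#})"
      have "\<nabla> (V F) \<sqsubseteq> V F" using properties[OF \<open>L \<in> C\<close>] F by simp
      then have "c \<sqsubseteq> V F" using le_trans[of c "\<nabla> (V F)" "V F"] c F nabla_closed by simp
      then show "c \<sqsubseteq> join_of \<Delta>" using prem[of "\<Gamma> + {#F#}" "\<Delta>" c] RuleL c by simp
    qed
  next
    case (RuleD \<Gamma> F \<Delta> G)
    have F: "F \<in> formulas C" "G \<in> formulas C" "set_mset \<Gamma> \<subseteq> formulas C" "set_mset \<Delta> \<subseteq> formulas C"
      using seq assms(2) RuleD by (auto simp: formulas_H)
    show ?thesis
    proof (rule concl[OF RuleD(2)])
      fix c assume c: "c \<in> carrier A" "below c (\<Gamma> + {#F \<^bold>\<or> G#})"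
      \<comment> \<open>With a context the premises bound only the parts of \<open>c\<close> below
        each disjunct; distributivity then reassembles \<open>c\<close> from these two
        parts.\<close>
      have "c \<sqinter> V X \<sqsubseteq> join_of \<Delta>" if X: "X = F \<or> X = G" for X
      proof -
        have m: "X \<in> formulas C" "c \<sqinter> V X \<in> carrier A" using X F c by auto
        then have "c \<sqinter> V X \<sqsubseteq> c" "c \<sqinter> V X \<sqsubseteq> V X" using c by (simp_all add: meet_left meet_right)
        then show ?thesis
          using below_mono[OF F(3) c(1) m(2)] prem[of "\<Gamma> + {#X#}" "\<Delta>" "c \<sqinter> V X"] RuleD X c m by auto
      qed
      then have "(c \<sqinter> V F) \<squnion> (c \<sqinter> V G) \<sqsubseteq> join_of \<Delta>" using c F by (simp add: join_le_iff)
      moreover have "c \<sqinter> (V F \<squnion> V G) = (c \<sqinter> V F) \<squnion> (c \<sqinter> V G)"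
        using properties[OF \<open>D \<in> C\<close>] c F by simp
      moreover have "c = c \<sqinter> (V F \<squnion> V G)" using c F le_iff_join[of c "V F \<squnion> V G"] by simp
      ultimately show "c \<sqsubseteq> join_of \<Delta>" by simp
    qed
  next
    case (RuleN \<Gamma> \<Delta>)
    have F: "set_mset \<Gamma> \<subseteq> formulas C" "set_mset \<Delta> \<subseteq> formulas C" "size \<Delta> \<le> 1"
      using seq RuleN by auto
    show ?thesis
    proof (rule concl[OF RuleN(2)])
      fix c assume c: "c \<in> carrier A" "below c (image_mset Nabla \<Gamma>)"
      \<comment> \<open>The element \<open>c\<close> lies below the values of the formulas
        \<nabla>\<gamma>, but the premise needs an element below those of the \<gamma>
        themselves.\<close>
      obtain m where m: "m \<in> carrier A" "below m \<Gamma>" "c \<sqsubseteq> \<nabla> m"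
        using nabla_cover[OF \<open>N \<in> C\<close> F(1) c] by blast
      have "m \<sqsubseteq> join_of \<Delta>" using prem[of "\<Gamma>" "\<Delta>" m] RuleN m by simp
      then have "\<nabla> m \<sqsubseteq> \<nabla> (join_of \<Delta>)" using nabla_mono m F by simp
      then show "c \<sqsubseteq> join_of (image_mset Nabla \<Delta>)"
        unfolding join_of_nabla[OF F(2,3)]
        using le_trans m c F nabla_closed join_of_closed by meson
    qed
  next
    case (RuleFa \<Gamma> F G)
    have F: "F \<in> formulas C" "G \<in> formulas C" "set_mset \<Gamma> \<subseteq> formulas C"
      using seq assms(2) RuleFa by (auto simp: formulas_H)
    show ?thesis
    proof (rule concl[OF RuleFa(2)])
      fix c assume c: "c \<in> carrier A" "below c \<Gamma>"
      obtain d where d: "d \<in> carrier A" "c = \<nabla> d"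
        using properties[OF \<open>Fa \<in> C\<close>] c unfolding has_property.simps by blast
      have m: "c \<sqinter> V F \<in> carrier A" using c F by simp
      have "c \<sqinter> V F \<sqsubseteq> c" "c \<sqinter> V F \<sqsubseteq> V F" using c F by (simp_all add: meet_left meet_right)
      then have "c \<sqinter> V F \<sqsubseteq> V G"
        using below_mono[OF F(3) c(1) m] prem[of "\<Gamma> + {#F#}" "{#G#}" "c \<sqinter> V F"] RuleFa c m F by simp
      \<comment> \<open>Since \<open>c\<close> is \<open>\<nabla> d\<close>, the inequality just
        obtained has the shape that the adjunction transposes; applying \<nabla> to the result leads
        back to \<open>c\<close>.\<close>
      then have "d \<sqsubseteq> V F \<rightharpoondown> V G" using adjunction d F by simp
      then show "c \<sqsubseteq> join_of {#\<^bold>\<nabla> (F \<^bold>\<rightarrow> G)#}"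
        using nabla_mono d F arrow_closed nabla_closed by simp
    qed
  next
    case (RuleFu \<Gamma> F G \<Delta>)
    have F: "F \<in> formulas C" "G \<in> formulas C" "set_mset \<Gamma> \<subseteq> formulas C" "set_mset \<Delta> \<subseteq> formulas C" "size \<Delta> \<le> 1"
      using seq assms(2) RuleFu by (auto simp: formulas_H)
    show ?thesis
    proof (rule concl[OF RuleFu(2)])
      fix c assume c: "c \<in> carrier A" "below c (\<Gamma> + {#F \<^bold>\<rightarrow> G#})"
      have nc: "\<nabla> c \<in> carrier A" using c nabla_closed by blast
      obtain d where d: "d \<in> carrier A" "join_of \<Delta> = \<top> \<rightharpoondown> d"
        using properties[OF \<open>Fu \<in> C\<close>] join_of_closed[OF F(4)] unfolding has_property.simps by blast
      have b: "below (\<nabla> c) (image_mset Nabla \<Gamma>)" using below_nabla[OF F(3) c(1)] c by simp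
      then have "\<nabla> c \<sqsubseteq> V F" using prem[of "image_mset Nabla \<Gamma>" "{#F#}" "\<nabla> c"] RuleFu nc F by simp
      moreover have "\<nabla> c \<sqsubseteq> \<nabla> (V F \<rightharpoondown> V G)" using nabla_mono c F arrow_closed by simp
      ultimately have "\<nabla> c \<sqsubseteq> V G" using nabla_arrow_elim nc F by (meson V_closed)
      then have "\<nabla> c \<sqsubseteq> join_of (image_mset Nabla \<Delta>)"
        using prem[of "image_mset Nabla \<Gamma> + {#G#}" "image_mset Nabla \<Delta>" "\<nabla> c"] b RuleFu nc by simp
      \<comment> \<open>Here \<nabla> is cancelled: the counit at \<top> turns this into
        \<open>\<nabla> c \<sqsubseteq> d\<close>, and the adjunction turns that into
        \<open>c \<sqsubseteq> \<top> \<rightharpoondown> d\<close>.\<close>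
      then have "\<nabla> c \<sqsubseteq> \<nabla> (\<top> \<rightharpoondown> d)" unfolding join_of_nabla[OF F(4,5)] d(2) .
      then have "\<nabla> c \<sqsubseteq> d" using nabla_arrow_elim[of \<top> d "\<nabla> c"] d nc by simp
      then have "\<nabla> c \<sqinter> \<top> \<sqsubseteq> d" using nc d le_trans by (meson meet_closed meet_left top_closed)
      then show "c \<sqsubseteq> join_of \<Delta>" using adjunction c d by simp
    qed
  next
    case (RuleHL \<Gamma> F G \<Delta>)
    have F: "F \<in> formulas C" "G \<in> formulas C"
      using seq assms(2) RuleHL by (auto simp: formulas_H)
    show ?thesis
    proof (rule concl[OF RuleHL(2)])
      fix c assume c: "c \<in> carrier A" "below c (\<Gamma> + {#F \<^bold>\<supset> G#})"
      have "c \<sqsubseteq> V F" using prem[of "\<Gamma>" "{#F#}" c] RuleHL c F by simp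
      then have "c \<sqsubseteq> c \<sqinter> V F" using c F by (simp add: le_meet_iff)
      moreover have "c \<sqinter> V F \<sqsubseteq> V G" using c le_V_HImp_iff[OF \<open>H \<in> C\<close>] by simp
      ultimately have "c \<sqsubseteq> V G" using le_trans c F by (meson V_closed meet_closed)
      then show "c \<sqsubseteq> join_of \<Delta>" using prem[of "\<Gamma> + {#G#}" "\<Delta>" c] RuleHL c by simp
    qed
  next
    case (RuleHR \<Gamma> F G)
    have F: "F \<in> formulas C" "G \<in> formulas C" "set_mset \<Gamma> \<subseteq> formulas C"
      using seq assms(2) RuleHR by (auto simp: formulas_H)
    show ?thesis
    proof (rule concl[OF RuleHR(2)])
      fix c assume c: "c \<in> carrier A" "below c \<Gamma>"
      have m: "c \<sqinter> V F \<in> carrier A" using c F by simp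
      have "c \<sqinter> V F \<sqsubseteq> c" "c \<sqinter> V F \<sqsubseteq> V F" using c F by (simp_all add: meet_left meet_right)
      then have "c \<sqinter> V F \<sqsubseteq> V G"
        using below_mono[OF F(3) c(1) m] prem[of "\<Gamma> + {#F#}" "{#G#}" "c \<sqinter> V F"] RuleHR c m F by simp
      then show "c \<sqsubseteq> join_of {#F \<^bold>\<supset> G#}" using c le_V_HImp_iff[OF \<open>H \<in> C\<close>] \<open>H \<in> C\<close> by simp
    qed
  qed
qed

lemma derivable_sound:
  assumes "derivable C S s" "\<forall>t\<in>S. validates A V t"
  shows "validates A V s"
  using assms(1)
proof induction
  case (step ps s)
  then show ?case using stl_rule_sound derivable_in_sequents by (meson subsetI)
qed (use assms(2) in blast)

end

lemma soundness:
  assumes "derivable C S s"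
  shows "entails TYPE('a) C S s"
  unfolding entails_def
proof (intro allI impI)
  fix A :: "'a nabla_structure" and V
  assume A: "A \<in> \<V> C" "valuation C A V" and S: "\<forall>t\<in>S. validates A V t"
  interpret nabla_algebra A using A by (simp add: \<V>_def)
  interpret nabla_model A C V by unfold_locales (use A in \<open>auto simp: \<V>_def\<close>)
  show "validates A V s" using derivable_sound[OF assms S] .
qed

section \<open>Completeness\<close>

locale stl_theory =
  fixes C :: "feature set" and S :: "'v sequent set"
begin

abbreviation deriv :: "'v fm multiset \<Rightarrow> 'v fm multiset \<Rightarrow> bool"  (infix \<open>\<turnstile>\<close> 50) where
  "\<Gamma> \<turnstile> \<Delta> \<equiv> derivable C S (\<Gamma> \<Rrightarrow> \<Delta>)"

abbreviation le_fm :: "'v fm \<Rightarrow> 'v fm \<Rightarrow> bool"  (infix \<open>\<preceq>\<close> 50) where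
  "A \<preceq> B \<equiv> {#A#} \<turnstile> {#B#}"

lemma deriv_formulas:
  assumes "\<Gamma> \<turnstile> \<Delta>"
  shows "set_mset \<Gamma> \<subseteq> formulas C" "set_mset \<Delta> \<subseteq> formulas C" "size \<Delta> \<le> 1"
  using derivable_in_sequents[OF assms] by auto

lemma le_fm_formulas: "A \<preceq> B \<Longrightarrow> A \<in> formulas C \<and> B \<in> formulas C"
  using deriv_formulas[of "{#A#}" "{#B#}"] by auto

lemma deriv_rule0: "stl_rule C [] s \<Longrightarrow> s \<in> sequents C \<Longrightarrow> derivable C S s"
  by (auto intro: derivable.step)

lemma deriv_rule1:
  "stl_rule C [p] s \<Longrightarrow> derivable C S p \<Longrightarrow> s \<in> sequents C \<Longrightarrow> derivable C S s"
  by (auto intro: derivable.step)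

lemma deriv_rule2:
  "stl_rule C [p, q] s \<Longrightarrow> derivable C S p \<Longrightarrow> derivable C S q \<Longrightarrow> s \<in> sequents C \<Longrightarrow> derivable C S s"
  by (rule derivable.step[of _ "[p, q]"]) auto

lemma deriv_weaken: "\<Gamma> \<turnstile> \<Delta> \<Longrightarrow> A \<in> formulas C \<Longrightarrow> add_mset A \<Gamma> \<turnstile> \<Delta>"
  using deriv_rule1[OF stl_rule.WeakL] deriv_formulas[of \<Gamma> \<Delta>] by simp

lemma deriv_cut: "\<Gamma> \<turnstile> {#A#} \<Longrightarrow> add_mset A \<Theta> \<turnstile> \<Delta> \<Longrightarrow> \<Theta> + \<Gamma> \<turnstile> \<Delta>"
  using deriv_rule2[OF stl_rule.Cut[of C \<Gamma> A \<Theta> \<Delta>]] deriv_formulas[of \<Gamma> "{#A#}"]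
    deriv_formulas[of "add_mset A \<Theta>" \<Delta>] by simp

lemma deriv_contract: "add_mset A (add_mset A \<Gamma>) \<turnstile> \<Delta> \<Longrightarrow> add_mset A \<Gamma> \<turnstile> \<Delta>"
  using deriv_rule1[OF stl_rule.Contr[of C \<Gamma> A \<Delta>]] deriv_formulas[of "add_mset A (add_mset A \<Gamma>)" \<Delta>]
  by simp

text \<open>After weakening by \<open>c\<close>, each formula of \<Gamma> is cut against
  \<open>c\<close>, and the extra copy of \<open>c\<close> that the cut leaves is
  contracted.\<close>

lemma deriv_from_lower_bound:
  assumes "\<Gamma> \<turnstile> \<Delta>" "c \<in> formulas C" "\<forall>A\<in>#\<Gamma>. c \<preceq> A"
  shows "{#c#} \<turnstile> \<Delta>"
proof -
  have "add_mset c \<Gamma> \<turnstile> \<Delta>" using assms deriv_weaken by blast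
  then show ?thesis using assms(3)
  proof (induction \<Gamma>)
    case (add A \<Gamma>)
    have "add_mset A (add_mset c \<Gamma>) \<turnstile> \<Delta>" using add.prems(1) by (simp add: add_mset_commute)
    then have "add_mset c \<Gamma> + {#c#} \<turnstile> \<Delta>" using deriv_cut add.prems(2) by (meson union_single_eq_member add_mset_add_single)
    then show ?case using add deriv_contract by simp
  qed simp
qed

lemma le_fm_refl: "A \<in> formulas C \<Longrightarrow> A \<preceq> A"
  using deriv_rule0[OF stl_rule.Ax] by simp

lemma deriv_trans: "c \<preceq> A \<Longrightarrow> {#A#} \<turnstile> \<Delta> \<Longrightarrow> {#c#} \<turnstile> \<Delta>"
  using deriv_from_lower_bound[of "{#A#}" \<Delta> c] le_fm_formulas[of c A] by simp

lemma deriv_member: "set_mset \<Gamma> \<subseteq> formulas C \<Longrightarrow> A \<in># \<Gamma> \<Longrightarrow> \<Gamma> \<turnstile> {#A#}"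
proof (induction \<Gamma>)
  case (add B \<Gamma>)
  show ?case
  proof (cases "A \<in># \<Gamma>")
    case True
    then show ?thesis using add deriv_weaken by simp
  next
    case False
    then have AB: "A = B" using add.prems by simp
    have "add_mset B \<Gamma> \<turnstile> {#B#}" using add.prems(1)
    proof (induction \<Gamma>)
      case empty
      then show ?case using le_fm_refl by simp
    next
      case (add D \<Gamma>)
      then have "add_mset B \<Gamma> \<turnstile> {#B#}" by simp
      then have "add_mset D (add_mset B \<Gamma>) \<turnstile> {#B#}" using deriv_weaken add.prems by simp
      then show ?case by (simp add: add_mset_commute)
    qed
    then show ?thesis using AB by simp
  qed
qed simp

lemma deriv_AndR: "\<Gamma> \<turnstile> {#A#} \<Longrightarrow> \<Gamma> \<turnstile> {#B#} \<Longrightarrow> \<Gamma> \<turnstile> {#A \<^bold>\<and> B#}"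
  using deriv_rule2[OF stl_rule.AndR[of C \<Gamma> A B]] deriv_formulas[of \<Gamma> "{#A#}"]
    deriv_formulas[of \<Gamma> "{#B#}"] by simp

lemma And_le_left: "A \<in> formulas C \<Longrightarrow> B \<in> formulas C \<Longrightarrow> A \<^bold>\<and> B \<preceq> A"
  using deriv_rule1[OF stl_rule.AndL1[of C "{#}" A "{#A#}" B]] le_fm_refl by simp

lemma And_le_right: "A \<in> formulas C \<Longrightarrow> B \<in> formulas C \<Longrightarrow> A \<^bold>\<and> B \<preceq> B"
  using deriv_rule1[OF stl_rule.AndL2[of C "{#}" B "{#B#}" A]] le_fm_refl by simp

lemma le_And_iff:
  "A \<in> formulas C \<Longrightarrow> B \<in> formulas C \<Longrightarrow> c \<preceq> A \<^bold>\<and> B \<longleftrightarrow> c \<preceq> A \<and> c \<preceq> B"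
  using deriv_AndR[of "{#c#}" A B] deriv_trans[OF _ And_le_left, of c A B]
    deriv_trans[OF _ And_le_right, of c A B] by blast

lemma And_le_mono:
  assumes "A \<preceq> A'" "B \<preceq> B'"
  shows "A \<^bold>\<and> B \<preceq> A' \<^bold>\<and> B'"
proof -
  have "A \<in> formulas C" "B \<in> formulas C" using assms le_fm_formulas by auto
  then have "A \<^bold>\<and> B \<preceq> A'" "A \<^bold>\<and> B \<preceq> B'"
    using deriv_trans[OF And_le_left assms(1)] deriv_trans[OF And_le_right assms(2)] by auto
  then show ?thesis by (rule deriv_AndR)
qed

lemma Or_le_iff:
  assumes "A \<in> formulas C" "B \<in> formulas C"
  shows "A \<^bold>\<or> B \<preceq> c \<longleftrightarrow> A \<preceq> c \<and> B \<preceq> c"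
proof
  have "A \<preceq> A \<^bold>\<or> B" "B \<preceq> A \<^bold>\<or> B"
    using deriv_rule1[OF stl_rule.OrR1[of C "{#A#}" A B]] deriv_rule1[OF stl_rule.OrR2[of C "{#B#}" B A]]
      le_fm_refl assms by auto
  then show "A \<^bold>\<or> B \<preceq> c \<Longrightarrow> A \<preceq> c \<and> B \<preceq> c" using deriv_trans by blast
  show "A \<preceq> c \<and> B \<preceq> c \<Longrightarrow> A \<^bold>\<or> B \<preceq> c"
    using deriv_rule2[OF stl_rule.OrL[of C A "{#c#}" B]] assms le_fm_formulas by auto
qed

text \<open>Comma and conjunction are interchangeable on the left, the backward direction by a cut.
  This lets rules with two antecedent formulas be read as inequalities between formulas.\<close>

lemma deriv_pair_iff:
  assumes "A \<in> formulas C" "B \<in> formulas C"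
  shows "{#A, B#} \<turnstile> \<Delta> \<longleftrightarrow> {#A \<^bold>\<and> B#} \<turnstile> \<Delta>"
proof
  assume "{#A, B#} \<turnstile> \<Delta>"
  then show "{#A \<^bold>\<and> B#} \<turnstile> \<Delta>"
    using deriv_from_lower_bound[of "{#A, B#}" \<Delta> "A \<^bold>\<and> B"] And_le_left And_le_right assms by simp
next
  assume d: "{#A \<^bold>\<and> B#} \<turnstile> \<Delta>"
  have "{#A, B#} \<turnstile> {#A \<^bold>\<and> B#}" using deriv_AndR deriv_member assms by simp
  then show "{#A, B#} \<turnstile> \<Delta>" using deriv_cut[of "{#A, B#}" "A \<^bold>\<and> B" "{#}" \<Delta>] d by simp
qed

lemma le_Top: "A \<in> formulas C \<Longrightarrow> A \<preceq> Top"
  using deriv_weaken[of "{#}" "{#Top#}" A] deriv_rule0[OF stl_rule.TopR] by simp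

lemma Bot_deriv_empty: "{#Bot#} \<turnstile> {#}"
  using deriv_rule0[OF stl_rule.BotL] by simp

lemma Bot_le: "A \<in> formulas C \<Longrightarrow> Bot \<preceq> A"
  using deriv_rule1[OF stl_rule.WeakR[of C "{#Bot#}" A]] Bot_deriv_empty by simp

text \<open>Right weakening introduces \<open>Bot\<close>, and the axiom for \<open>Bot\<close>
  removes it; thus the empty succedent behaves as the least element.\<close>

lemma deriv_empty_iff: "{#A#} \<turnstile> {#} \<longleftrightarrow> A \<preceq> Bot"
proof
  assume "{#A#} \<turnstile> {#}"
  then show "A \<preceq> Bot"
    using deriv_rule1[OF stl_rule.WeakR[of C "{#A#}" Bot]] deriv_formulas[of "{#A#}" "{#}"] by simp
qed (use deriv_trans Bot_deriv_empty in blast)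

lemma Nabla_le_mono: "A \<preceq> B \<Longrightarrow> \<^bold>\<nabla> A \<preceq> \<^bold>\<nabla> B"
  using deriv_rule1[OF stl_rule.NablaLR[of C A B]] le_fm_formulas[of A B] by simp

text \<open>The counit of the adjunction, obtained from the left implication rule with
  \<open>A\<close> as its context.\<close>

lemma Nabla_Imp_elim: 
  assumes "A \<in> formulas C" "B \<in> formulas C"
  shows "\<^bold>\<nabla> (A \<^bold>\<rightarrow> B) \<^bold>\<and> A \<preceq> B"
proof -
  have "{#\<^bold>\<nabla> (A \<^bold>\<rightarrow> B), A#} \<turnstile> {#B#}"
    using deriv_rule2[OF stl_rule.ImpL[of C "{#A#}" A B "{#B#}"]] deriv_member assms
    by (simp add: add_mset_commute)
  then show ?thesis using deriv_pair_iff assms by simp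
qed

text \<open>Forwards this is the right implication rule with \<open>c\<close> as its context;
  backwards it is monotonicity of \<nabla> followed by the counit.\<close>

lemma Imp_adjunction:
  assumes "A \<in> formulas C" "B \<in> formulas C" "c \<in> formulas C"
  shows "\<^bold>\<nabla> c \<^bold>\<and> A \<preceq> B \<longleftrightarrow> c \<preceq> A \<^bold>\<rightarrow> B"
proof
  assume "\<^bold>\<nabla> c \<^bold>\<and> A \<preceq> B"
  then have "{#\<^bold>\<nabla> c, A#} \<turnstile> {#B#}" using deriv_pair_iff assms by simp
  then show "c \<preceq> A \<^bold>\<rightarrow> B"
    using deriv_rule1[OF stl_rule.ImpR[of C "{#c#}" A B]] assms by (simp add: add_mset_commute)
next
  assume "c \<preceq> A \<^bold>\<rightarrow> B"
  then have "\<^bold>\<nabla> c \<preceq> \<^bold>\<nabla> (A \<^bold>\<rightarrow> B)" by (rule Nabla_le_mono)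
  then have "\<^bold>\<nabla> c \<^bold>\<and> A \<preceq> \<^bold>\<nabla> (A \<^bold>\<rightarrow> B) \<^bold>\<and> A" by (rule And_le_mono[OF _ le_fm_refl[OF assms(1)]])
  then show "\<^bold>\<nabla> c \<^bold>\<and> A \<preceq> B" by (rule deriv_trans[OF _ Nabla_Imp_elim[OF assms(1,2)]])
qed

text \<open>By the adjunction it is enough to derive \<open>B'\<close> from \<open>A'\<close> and
  \<open>Nabla (Imp A B)\<close>. This makes the arrow on classes of formulas independent of
  representatives.\<close>

lemma Imp_le_mono:
  assumes "A' \<preceq> A" "B \<preceq> B'"
  shows "A \<^bold>\<rightarrow> B \<preceq> A' \<^bold>\<rightarrow> B'"
proof -
  have F: "A \<in> formulas C" "A' \<in> formulas C" "B \<in> formulas C" "B' \<in> formulas C"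
    using assms le_fm_formulas by auto
  let ?N = "\<^bold>\<nabla> (A \<^bold>\<rightarrow> B)"
  have "?N \<^bold>\<and> A' \<preceq> ?N \<^bold>\<and> A" using And_le_mono[OF le_fm_refl assms(1)] F by simp
  then have "?N \<^bold>\<and> A' \<preceq> B" by (rule deriv_trans[OF _ Nabla_Imp_elim[OF F(1,3)]])
  then have "?N \<^bold>\<and> A' \<preceq> B'" using assms(2) by (rule deriv_trans)
  then show ?thesis using Imp_adjunction F by simp
qed

lemma HImp_adjunction:
  assumes "H \<in> C"
  shows "c \<^bold>\<and> A \<preceq> B \<longleftrightarrow> c \<preceq> A \<^bold>\<supset> B"
proof -
  have F: "X \<in> formulas C" for X :: "'v fm" using formulas_H assms by blast
  show ?thesis
  proof
    assume "c \<^bold>\<and> A \<preceq> B"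
    then have "{#c, A#} \<turnstile> {#B#}" using deriv_pair_iff F by simp
    then show "c \<preceq> A \<^bold>\<supset> B"
      using deriv_rule1[OF stl_rule.RuleHR[OF assms, of "{#c#}" A B]] F by (simp add: add_mset_commute)
  next
    assume c: "c \<preceq> A \<^bold>\<supset> B"
    have "{#A \<^bold>\<supset> B, A#} \<turnstile> {#B#}"
      using deriv_rule2[OF stl_rule.RuleHL[OF assms, of "{#A#}" A B "{#B#}"]] deriv_member F
      by (simp add: add_mset_commute subset_iff)
    then have "(A \<^bold>\<supset> B) \<^bold>\<and> A \<preceq> B" using deriv_pair_iff F by simp
    moreover have "c \<^bold>\<and> A \<preceq> (A \<^bold>\<supset> B) \<^bold>\<and> A" using And_le_mono[OF c le_fm_refl[OF F]] .
    ultimately show "c \<^bold>\<and> A \<preceq> B" by (rule deriv_trans[rotated])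
  qed
qed

text \<open>Rule \<open>D\<close> with \<open>A\<close> as its context; this is the half of
  distributivity that fails in general lattices.\<close>

lemma Or_distrib:
  assumes "D \<in> C" "A \<in> formulas C" "B \<in> formulas C" "E \<in> formulas C"
  shows "A \<^bold>\<and> (B \<^bold>\<or> E) \<preceq> (A \<^bold>\<and> B) \<^bold>\<or> (A \<^bold>\<and> E)"
proof -
  let ?X = "(A \<^bold>\<and> B) \<^bold>\<or> (A \<^bold>\<and> E)"
  have "?X \<preceq> ?X" using le_fm_refl assms by simp
  then have "A \<^bold>\<and> B \<preceq> ?X" "A \<^bold>\<and> E \<preceq> ?X" using Or_le_iff assms by simp_all
  then have "{#A, B#} \<turnstile> {#?X#}" "{#A, E#} \<turnstile> {#?X#}" using deriv_pair_iff assms by auto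
  then have "{#A, B \<^bold>\<or> E#} \<turnstile> {#?X#}"
    using deriv_rule2[OF stl_rule.RuleD[OF assms(1), of "{#A#}" B "{#?X#}" E]] assms
    by (simp add: add_mset_commute)
  then show ?thesis using deriv_pair_iff assms by simp
qed

lemma le_Nabla: "R \<in> C \<Longrightarrow> A \<in> formulas C \<Longrightarrow> A \<preceq> \<^bold>\<nabla> A"
  using deriv_rule1[OF stl_rule.RuleR[of C "{#A#}" A]] le_fm_refl by simp

lemma Nabla_le: "L \<in> C \<Longrightarrow> A \<in> formulas C \<Longrightarrow> \<^bold>\<nabla> A \<preceq> A"
  using deriv_rule1[OF stl_rule.RuleL[of C "{#}" A "{#A#}"]] le_fm_refl by simp

text \<open>Rule \<open>N\<close> with an empty antecedent, applied to the axiom for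
  \<open>Top\<close> and then weakened.\<close>

lemma Top_le_Nabla_Top: "N \<in> C \<Longrightarrow> Top \<preceq> \<^bold>\<nabla> Top"
  using deriv_rule1[OF stl_rule.RuleN[of C "{#}" "{#Top#}"]] deriv_rule0[OF stl_rule.TopR]
    deriv_weaken[of "{#}" "{#\<^bold>\<nabla> Top#}" Top] by simp

lemma And_Nabla_le:
  assumes "N \<in> C" "A \<in> formulas C" "B \<in> formulas C"
  shows "\<^bold>\<nabla> A \<^bold>\<and> \<^bold>\<nabla> B \<preceq> \<^bold>\<nabla> (A \<^bold>\<and> B)"
proof -
  have "{#A, B#} \<turnstile> {#A \<^bold>\<and> B#}" using deriv_AndR deriv_member assms by simp
  then have "{#\<^bold>\<nabla> A, \<^bold>\<nabla> B#} \<turnstile> {#\<^bold>\<nabla> (A \<^bold>\<and> B)#}"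
    using deriv_rule1[OF stl_rule.RuleN[OF assms(1), of "{#A, B#}" "{#A \<^bold>\<and> B#}"]] assms by simp
  then show ?thesis using deriv_pair_iff assms by simp
qed

text \<open>The first inequality is \<open>Fa\<close> with \<open>Top\<close> as the discharged
  formula. The second is the left implication rule, whose premise for \<open>Top\<close> is an
  axiom.\<close>

lemma Nabla_Imp_Top:
  assumes "Fa \<in> C" "A \<in> formulas C"
  shows "A \<preceq> \<^bold>\<nabla> (Top \<^bold>\<rightarrow> A)" "\<^bold>\<nabla> (Top \<^bold>\<rightarrow> A) \<preceq> A"
proof -
  have "{#Top, A#} \<turnstile> {#A#}" using deriv_member assms by simp
  then show "A \<preceq> \<^bold>\<nabla> (Top \<^bold>\<rightarrow> A)"
    using deriv_rule1[OF stl_rule.RuleFa[OF assms(1), of "{#A#}" Top A]] assms by simp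
  show "\<^bold>\<nabla> (Top \<^bold>\<rightarrow> A) \<preceq> A"
    using deriv_rule2[OF stl_rule.ImpL[of C "{#}" Top A "{#A#}"]] deriv_rule0[OF stl_rule.TopR]
      le_fm_refl assms by simp
qed

text \<open>The first inequality is the unit of the adjunction. The second is \<open>Fu\<close> with
  empty context, whose premises are the axiom for \<open>Top\<close> and an identity axiom on
  \<open>Nabla A\<close>.\<close>

lemma Imp_Top_Nabla:
  assumes "Fu \<in> C" "A \<in> formulas C"
  shows "A \<preceq> Top \<^bold>\<rightarrow> \<^bold>\<nabla> A" "Top \<^bold>\<rightarrow> \<^bold>\<nabla> A \<preceq> A"
proof -
  show "A \<preceq> Top \<^bold>\<rightarrow> \<^bold>\<nabla> A"
    using Imp_adjunction[of Top "\<^bold>\<nabla> A" A] And_le_left[of "\<^bold>\<nabla> A" Top] assms(2) by simp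
  show "Top \<^bold>\<rightarrow> \<^bold>\<nabla> A \<preceq> A"
    using deriv_rule2[OF stl_rule.RuleFu[OF assms(1), of "{#}" Top "\<^bold>\<nabla> A" "{#A#}"]]
      deriv_rule0[OF stl_rule.TopR] le_fm_refl assms by simp
qed

text \<open>The witness is the iterated conjunction of \<Gamma>, ending in \<open>Top\<close>. It is
  the formula at which validity in the Lindenbaum algebra is tested to recover derivability.\<close>

lemma conjunction_exists:
  assumes "set_mset \<Gamma> \<subseteq> formulas C"
  shows "\<exists>c\<in>formulas C. (\<forall>A\<in>#\<Gamma>. c \<preceq> A) \<and> \<Gamma> \<turnstile> {#c#}"
  using assms
proof (induction \<Gamma>)
  case empty
  then show ?case using deriv_rule0[OF stl_rule.TopR] by (intro bexI[of _ Top]) auto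
next
  case (add A \<Gamma>)
  then obtain c where c: "c \<in> formulas C" "\<forall>A\<in>#\<Gamma>. c \<preceq> A" "\<Gamma> \<turnstile> {#c#}" by auto
  have A: "A \<in> formulas C" using add.prems by simp
  have "add_mset A \<Gamma> \<turnstile> {#A \<^bold>\<and> c#}"
    using deriv_AndR deriv_weaken[OF c(3) A] deriv_member[OF add.prems] by simp
  moreover have "\<forall>B\<in>#add_mset A \<Gamma>. A \<^bold>\<and> c \<preceq> B"
    using And_le_left[OF A c(1)] And_le_right[OF A c(1)] c(2) deriv_trans by auto
  ultimately show ?case using A c(1) by (intro bexI[of _ "A \<^bold>\<and> c"]) auto
qed

end

text \<open>The Lindenbaum algebra is carried into the type \<open>'a\<close> by choosing a representative of each
  class of interderivable formulas.\<close>

locale lindenbaum = stl_theory C S for C :: "feature set" and S :: "'v sequent set" +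
  fixes f :: "'v fm \<Rightarrow> 'a"
  assumes inj_f: "inj f"
begin

definition cls :: "'v fm \<Rightarrow> 'a" where
  "cls A = f (SOME B. A \<preceq> B \<and> B \<preceq> A)"

definition rep :: "'a \<Rightarrow> 'v fm" where
  "rep x = (SOME A. A \<in> formulas C \<and> cls A = x)"

text \<open>Only the order, \<nabla> and the arrow are given, all computed on representatives;
  meets, joins and bounds are determined by the order.\<close>

definition LA :: "'a nabla_structure" where
  "LA = \<lparr>carrier = cls ` formulas C, eq = (=), le = (\<lambda>x y. rep x \<preceq> rep y),
     nabla = (\<lambda>x. cls (\<^bold>\<nabla> (rep x))), arrow = (\<lambda>x y. cls (rep x \<^bold>\<rightarrow> rep y))\<rparr>"

text \<open>Interderivable formulas determine the same predicate, hence the same chosen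
  representative. Conversely, injectivity of \<open>f\<close> yields a common representative,
  interderivable with both formulas.\<close>

lemma cls_eq_iff:
  assumes "A \<in> formulas C" "B \<in> formulas C"
  shows "cls A = cls B \<longleftrightarrow> A \<preceq> B \<and> B \<preceq> A"
proof
  assume "A \<preceq> B \<and> B \<preceq> A"
  then have "(\<lambda>X. A \<preceq> X \<and> X \<preceq> A) = (\<lambda>X. B \<preceq> X \<and> X \<preceq> B)" using deriv_trans by blast
  then show "cls A = cls B" unfolding cls_def by simp
next
  let ?a = "SOME X. A \<preceq> X \<and> X \<preceq> A" and ?b = "SOME X. B \<preceq> X \<and> X \<preceq> B"
  assume "cls A = cls B"
  then have eq: "?a = ?b" unfolding cls_def using inj_f by (simp add: inj_eq)
  have "A \<preceq> ?a \<and> ?a \<preceq> A" by (rule someI[of _ A]) (simp add: le_fm_refl assms)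
  moreover have "B \<preceq> ?b \<and> ?b \<preceq> B" by (rule someI[of _ B]) (simp add: le_fm_refl assms)
  ultimately show "A \<preceq> B \<and> B \<preceq> A"
    unfolding eq using deriv_trans[of A ?b] deriv_trans[of B ?b] by blast
qed

lemma rep_cls:
  assumes "A \<in> formulas C"
  shows "rep (cls A) \<in> formulas C" "A \<preceq> rep (cls A)" "rep (cls A) \<preceq> A"
proof -
  have "rep (cls A) \<in> formulas C \<and> cls (rep (cls A)) = cls A"
    unfolding rep_def by (rule someI[of _ A]) (simp add: assms)
  then show "rep (cls A) \<in> formulas C" "A \<preceq> rep (cls A)" "rep (cls A) \<preceq> A"
    using cls_eq_iff assms by auto
qed

lemma carrier_LA: "carrier LA = cls ` formulas C"
  by (simp add: LA_def)

lemma cls_closed [simp]: "A \<in> formulas C \<Longrightarrow> cls A \<in> carrier LA"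
  by (simp add: carrier_LA)

lemma le_LA_iff [simp]:
  assumes "A \<in> formulas C" "B \<in> formulas C"
  shows "cls A \<sqsubseteq>\<^bsub>LA\<^esub> cls B \<longleftrightarrow> A \<preceq> B"
proof -
  have "rep (cls A) \<preceq> rep (cls B) \<longleftrightarrow> A \<preceq> B"
    using deriv_trans[OF rep_cls(2)[OF assms(1)]] deriv_trans[OF rep_cls(3)[OF assms(1)]]
      deriv_trans[OF _ rep_cls(2)[OF assms(2)]] deriv_trans[OF _ rep_cls(3)[OF assms(2)]] by metis
  then show ?thesis by (simp add: LA_def)
qed

lemma nabla_LA [simp]: "A \<in> formulas C \<Longrightarrow> \<nabla>\<^bsub>LA\<^esub> (cls A) = cls (\<^bold>\<nabla> A)"
  using rep_cls by (simp add: LA_def cls_eq_iff Nabla_le_mono)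

lemma arrow_LA [simp]:
  "A \<in> formulas C \<Longrightarrow> B \<in> formulas C \<Longrightarrow> cls A \<rightharpoondown>\<^bsub>LA\<^esub> cls B = cls (A \<^bold>\<rightarrow> B)"
  using rep_cls by (simp add: LA_def cls_eq_iff Imp_le_mono)

section \<open>The Lindenbaum algebra as a \<nabla>-algebra with the required properties\<close>

lemma partial_order_LA: "partial_order LA"
proof -
  have eq: "(.=\<^bsub>LA\<^esub>) = (=)" by (simp add: LA_def)
  show ?thesis
  proof
    fix x y z
    assume "x \<sqsubseteq>\<^bsub>LA\<^esub> y" "y \<sqsubseteq>\<^bsub>LA\<^esub> z"
    then show "x \<sqsubseteq>\<^bsub>LA\<^esub> z" unfolding LA_def by (simp add: deriv_trans[of "rep x" "rep y"])
  next
    fix x y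
    assume "x \<sqsubseteq>\<^bsub>LA\<^esub> y" "y \<sqsubseteq>\<^bsub>LA\<^esub> x" "x \<in> carrier LA" "y \<in> carrier LA"
    then show "x .=\<^bsub>LA\<^esub> y" unfolding eq by (auto simp: carrier_LA cls_eq_iff)
  qed (auto simp: eq carrier_LA le_fm_refl)
qed

lemma greatest_And:
  assumes "A \<in> formulas C" "B \<in> formulas C"
  shows "greatest LA (cls (A \<^bold>\<and> B)) (Lower LA {cls A, cls B})"
proof (rule greatest_LowerI)
  show "cls (A \<^bold>\<and> B) \<sqsubseteq>\<^bsub>LA\<^esub> x" if "x \<in> {cls A, cls B}" for x
    using that assms And_le_left And_le_right by auto
  show "y \<sqsubseteq>\<^bsub>LA\<^esub> cls (A \<^bold>\<and> B)" if y: "y \<in> Lower LA {cls A, cls B}" for y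
  proof -
    obtain c where c: "c \<in> formulas C" "y = cls c"
      using subsetD[OF Lower_closed y] by (auto simp: carrier_LA)
    have "y \<sqsubseteq>\<^bsub>LA\<^esub> cls A" "y \<sqsubseteq>\<^bsub>LA\<^esub> cls B"
      using Lower_memD[OF y] assms by auto
    then show ?thesis using c assms le_And_iff by simp
  qed
qed (use assms in auto)

lemma least_Or:
  assumes "A \<in> formulas C" "B \<in> formulas C"
  shows "least LA (cls (A \<^bold>\<or> B)) (Upper LA {cls A, cls B})"
proof (rule least_UpperI)
  have "A \<^bold>\<or> B \<preceq> A \<^bold>\<or> B" using assms le_fm_refl by simp
  then show "x \<sqsubseteq>\<^bsub>LA\<^esub> cls (A \<^bold>\<or> B)" if "x \<in> {cls A, cls B}" for x
    using that assms Or_le_iff by auto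
  show "cls (A \<^bold>\<or> B) \<sqsubseteq>\<^bsub>LA\<^esub> y" if y: "y \<in> Upper LA {cls A, cls B}" for y
  proof -
    obtain c where c: "c \<in> formulas C" "y = cls c"
      using subsetD[OF Upper_closed y] by (auto simp: carrier_LA)
    have "cls A \<sqsubseteq>\<^bsub>LA\<^esub> y" "cls B \<sqsubseteq>\<^bsub>LA\<^esub> y"
      using Upper_memD[OF y] assms by auto
    then show ?thesis using c assms Or_le_iff by simp
  qed
qed (use assms in auto)

lemma greatest_Top: "greatest LA (cls Top) (carrier LA)"
  by (auto simp: greatest_def carrier_LA le_Top)

lemma least_Bot: "least LA (cls Bot) (carrier LA)"
  by (auto simp: least_def carrier_LA Bot_le)

lemma bounded_lattice_LA: "bounded_lattice LA"
proof -
  interpret partial_order LA by (rule partial_order_LA)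
  show ?thesis
  proof
    fix x y assume "x \<in> carrier LA" "y \<in> carrier LA"
    then obtain A B where "A \<in> formulas C" "x = cls A" "B \<in> formulas C" "y = cls B"
      by (auto simp: carrier_LA)
    then show "\<exists>s. least LA s (Upper LA {x, y})" "\<exists>s. greatest LA s (Lower LA {x, y})"
      using greatest_And least_Or by blast+
  qed (use greatest_Top least_Bot in blast)+
qed

sublocale LA: bounded_lattice LA
  by (rule bounded_lattice_LA)

lemma top_LA [simp]: "\<top>\<^bsub>LA\<^esub> = cls Top"
  by (rule LA.greatest_unique[OF LA.top_greatest greatest_Top])

lemma bottom_LA [simp]: "\<bottom>\<^bsub>LA\<^esub> = cls Bot"
  by (rule LA.least_unique[OF LA.bottom_least least_Bot])

text \<open>Greatest lower bounds are unique in a partial order, so the meet that the order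
  determines is the class of the conjunction.\<close>

lemma meet_LA [simp]:
  "A \<in> formulas C \<Longrightarrow> B \<in> formulas C \<Longrightarrow> cls A \<sqinter>\<^bsub>LA\<^esub> cls B = cls (A \<^bold>\<and> B)"
  unfolding meet_def by (rule LA.greatest_unique[OF LA.inf_of_two_greatest greatest_And]) simp_all

lemma join_LA [simp]:
  "A \<in> formulas C \<Longrightarrow> B \<in> formulas C \<Longrightarrow> cls A \<squnion>\<^bsub>LA\<^esub> cls B = cls (A \<^bold>\<or> B)"
  unfolding join_def by (rule LA.least_unique[OF LA.sup_of_two_least least_Or]) simp_all

lemma heyting_LA:
  assumes "H \<in> C"
  shows "is_heyting_imp LA (cls A) (cls B) (cls (A \<^bold>\<supset> B))"
  unfolding is_heyting_imp_def using assms
  by (auto simp: carrier_LA formulas_H HImp_adjunction)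

lemma nabla_algebra_LA: "nabla_algebra LA"
proof
  fix a b c assume "a \<in> carrier LA" "b \<in> carrier LA" "c \<in> carrier LA"
  then show "\<nabla>\<^bsub>LA\<^esub> c \<sqinter>\<^bsub>LA\<^esub> a \<sqsubseteq>\<^bsub>LA\<^esub> b \<longleftrightarrow> c \<sqsubseteq>\<^bsub>LA\<^esub> a \<rightharpoondown>\<^bsub>LA\<^esub> b"
    using Imp_adjunction by (auto simp: carrier_LA)
qed (auto simp: carrier_LA)

text \<open>An equation between classes splits into two inequalities between formulas: one comes
  from the additional rule, the other is already available in the basic calculus. For
  \<open>Fa\<close> and \<open>Fu\<close> such an equation exhibits a preimage of each
  class.\<close>

lemma has_property_LA:
  assumes "P \<in> C"
  shows "has_property LA P"
proof (cases P)
  case N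
  have "\<^bold>\<nabla> (A \<^bold>\<and> B) \<preceq> \<^bold>\<nabla> A \<^bold>\<and> \<^bold>\<nabla> B" if "A \<in> formulas C" "B \<in> formulas C" for A B
    using that And_le_left And_le_right Nabla_le_mono le_And_iff by simp
  then show ?thesis
    using N assms Top_le_Nabla_Top le_Top And_Nabla_le by (auto simp: carrier_LA cls_eq_iff)
next
  case H
  then show ?thesis using assms heyting_LA by (auto simp: carrier_LA)
next
  case D
  have "(A \<^bold>\<and> B) \<^bold>\<or> (A \<^bold>\<and> E) \<preceq> A \<^bold>\<and> (B \<^bold>\<or> E)"
    if "A \<in> formulas C" "B \<in> formulas C" "E \<in> formulas C" for A B E
  proof -
    have "B \<^bold>\<or> E \<preceq> B \<^bold>\<or> E" using le_fm_refl that by simp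
    then have "B \<preceq> B \<^bold>\<or> E" "E \<preceq> B \<^bold>\<or> E" using Or_le_iff that by simp_all
    then show ?thesis using And_le_mono[OF le_fm_refl[OF that(1)]] that by (simp add: Or_le_iff)
  qed
  then show ?thesis using D assms Or_distrib by (auto simp: carrier_LA cls_eq_iff)
next
  case R
  then show ?thesis using assms le_Nabla by (auto simp: carrier_LA)
next
  case L
  then show ?thesis using assms Nabla_le by (auto simp: carrier_LA)
next
  case Fa
  have "cls A \<in> (\<lambda>a. \<nabla>\<^bsub>LA\<^esub> a) ` carrier LA" if "A \<in> formulas C" for A
    using that assms Fa Nabla_Imp_Top by (intro image_eqI[of _ _ "cls (Top \<^bold>\<rightarrow> A)"]) (simp_all add: cls_eq_iff)
  then show ?thesis using Fa by (auto simp: carrier_LA)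
next
  case Fu
  have "cls A \<in> (\<lambda>a. \<top>\<^bsub>LA\<^esub> \<rightharpoondown>\<^bsub>LA\<^esub> a) ` carrier LA" if "A \<in> formulas C" for A
    using that assms Fu Imp_Top_Nabla by (intro image_eqI[of _ _ "cls (\<^bold>\<nabla> A)"]) (simp_all add: cls_eq_iff)
  then show ?thesis using Fu by (auto simp: carrier_LA)
qed

text \<open>The connectives agree with the operations by the computation rules above; for \<supset>
  this rests on uniqueness of the residual.\<close>

lemma valuation_cls: "valuation C LA cls"
  unfolding valuation_def
  using LA.heyting_imp_eq[OF heyting_LA] by (auto simp: carrier_LA)

lemma nabla_model_LA: "nabla_model LA C cls"
  using nabla_algebra_LA has_property_LA valuation_cls
  by (simp add: nabla_model_def nabla_model_axioms_def)

text \<open>The truth lemma for the canonical model. Every element is the class of some formula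
  \<open>c\<close>, so validity says that each \<open>c\<close> below all of \<Gamma> derives
  \<Delta>; this is compared with derivability from \<Gamma> itself.\<close>

lemma validates_LA_iff:
  assumes "s \<in> sequents C"
  shows "validates LA cls s \<longleftrightarrow> derivable C S s"
proof -
  obtain \<Gamma> \<Delta> where s: "s = (\<Gamma> \<Rrightarrow> \<Delta>)" by (cases s)
  have F: "set_mset \<Gamma> \<subseteq> formulas C" "set_mset \<Delta> \<subseteq> formulas C" "size \<Delta> \<le> 1"
    using assms s by auto
  have suc: "cls c \<sqsubseteq>\<^bsub>LA\<^esub> \<Squnion>\<^bsub>LA\<^esub> (cls ` set_mset \<Delta>) \<longleftrightarrow> {#c#} \<turnstile> \<Delta>" if "c \<in> formulas C" for c
    using F(2,3) that deriv_empty_iff[of c] by (cases \<Delta>) auto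
  have ant: "(\<forall>A\<in>#\<Gamma>. cls c \<sqsubseteq>\<^bsub>LA\<^esub> cls A) \<longleftrightarrow> (\<forall>A\<in>#\<Gamma>. c \<preceq> A)" if "c \<in> formulas C" for c
    using F(1) that by (auto simp: subset_iff)
  have "validates LA cls s \<longleftrightarrow> (\<forall>c\<in>formulas C. (\<forall>A\<in>#\<Gamma>. c \<preceq> A) \<longrightarrow> {#c#} \<turnstile> \<Delta>)"
    unfolding s nabla_model.validates_iff[OF nabla_model_LA F(1,2)] carrier_LA using ant suc by simp
  also have "\<dots> \<longleftrightarrow> \<Gamma> \<turnstile> \<Delta>"
  proof
    assume all: "\<forall>c\<in>formulas C. (\<forall>A\<in>#\<Gamma>. c \<preceq> A) \<longrightarrow> {#c#} \<turnstile> \<Delta>"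
    obtain c where "c \<in> formulas C" "\<forall>A\<in>#\<Gamma>. c \<preceq> A" "\<Gamma> \<turnstile> {#c#}"
      using conjunction_exists[OF F(1)] by blast
    \<comment> \<open>The conjunction \<open>c\<close> derives \<Delta> by validity, and is cut
      against its derivation from \<Gamma>.\<close>
    then show "\<Gamma> \<turnstile> \<Delta>" using all deriv_cut[of \<Gamma> c "{#}" \<Delta>] by simp
  qed (use deriv_from_lower_bound in blast)
  finally show ?thesis unfolding s .
qed

end

text \<open>The Lindenbaum algebra with \<open>cls\<close> validates all of \<open>S\<close>, whose
  members are derivable as premises of the language. It is thus one of the models over
  \<open>'a\<close> that entailment quantifies over.\<close>

lemma completeness:
  fixes f :: "'v fm \<Rightarrow> 'a" and S :: "'v sequent set"
  assumes "inj f" "S \<subseteq> sequents C" "s \<in> sequents C" "entails TYPE('a) C S s"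
  shows "derivable C S s"
proof -
  interpret lindenbaum C S f by unfold_locales (rule assms(1))
  have "LA \<in> \<V> C" using nabla_algebra_LA has_property_LA by (simp add: \<V>_def)
  moreover have "validates LA cls t" if "t \<in> S" for t
    using that assms(2) validates_LA_iff derivable.premise by blast
  ultimately have "validates LA cls s"
    using assms(4) valuation_cls unfolding entails_def by blast
  then show ?thesis using validates_LA_iff assms(3) by blast
qed

text \<open>The class of all algebras is rendered through carrier types: the equivalence is asserted
  for each type \<open>'a\<close> with room for the formulas, and soundness for an arbitrary type
  \<open>'b\<close>.\<close>

theorem theorem6p5:
  fixes C :: "feature set"
    and S :: "'v sequent set"
    and s :: "'v sequent"
  assumes "S \<subseteq> sequents C" and "s \<in> sequents C"
  shows "((\<exists>f :: 'v fm \<Rightarrow> 'a. inj f) \<longrightarrow> (derivable C S s \<longleftrightarrow> entails TYPE('a) C S s))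
       \<and> (derivable C S s \<longrightarrow> entails TYPE('b) C S s)"
proof (intro conjI impI)
  assume "\<exists>f :: 'v fm \<Rightarrow> 'a. inj f"
  then obtain f :: "'v fm \<Rightarrow> 'a" where "inj f" ..
  then show "derivable C S s \<longleftrightarrow> entails TYPE('a) C S s"
    using soundness completeness[OF _ assms] by (intro iffI)
qed (rule soundness)

end
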